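(* Let $\mathcal M\subset\ell^2(\mathbb F_{n_1}^+\times\cdots\times\mathbb F_{n_k}^+)\otimes\mathcal K$ be a jointly invariant subspace under $S_{i,s}\otimes I_{\mathcal K}$, where $i\in\{1,\ldots,k\}$ and $s\in\{1,\ldots,n_i\}$. Then the following statements are equivalent. (i) $\mathcal M$ is a Beurling type jointly invariant subspace. (ii) $(id-\Phi_{S_1\otimes I_{\mathcal K}})\circ\cdots\circ(id-\Phi_{S_k\otimes I_{\mathcal K}})(P_{\mathcal M})\ge0$. (iii) The $k$-tuple $\big((S_1\otimes I_{\mathcal K})|_{\mathcal M},\ldots,(S_k\otimes I_{\mathcal K})|_{\mathcal M}\big)$ is doubly $\Lambda$-commuting. (iv) There is an isometric multi-analytic operator $\Psi:\ell^2(\mathbb F_{n_1}^+\times\cdots\times\mathbb F_{n_k}^+)\otimes\mathcal L\to\ell^2(\mathbb F_{n_1}^+\times\cdots\times\mathbb F_{n_k}^+)\otimes\mathcal K$, for some Hilbert space $\mathcal L$, such that $$\mathcal M=\Psi\big(\ell^2(\mathbb F_{n_1}^+\times\cdots\times\mathbb F_{n_k}^+)\otimes\mathcal L\big).$$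
   Context: Fix integers $k\ge1$, $n_1,\ldots,n_k\ge 1$ and, for $i\ne j$ in $\{1,\ldots,k\}$, an $n_i\times n_j$ matrix $\Lambda_{i,j}=[\lambda_{i,j}(s,t)]$ with entries in $\mathbb T=\{z\in\mathbb C:|z|=1\}$, such that $\lambda_{j,i}(t,s)=\overline{\lambda_{i,j}(s,t)}$. $\mathbb F_{n_i}^+$ is the unital free semigroup with generators $g_1^i,\ldots,g_{n_i}^i$ and neutral element $g_0^i$. The universal model (standard $k$-tuple) $S=(S_1,\ldots,S_k)$, $S_i=[S_{i,1}\cdots S_{i,n_i}]$, acts on $\ell^2(\mathbb F_{n_1}^+\times\cdots\times\mathbb F_{n_k}^+)$ with standard basis $\chi_{(\alpha_1,\ldots,\alpha_k)}$ by $$S_{i,s}\chi_{(\alpha_1,\ldots,\alpha_k)}=\boldsymbol\lambda_{i,1}(s,\alpha_1)\cdots\boldsymbol\lambda_{i,i-1}(s,\alpha_{i-1})\chi_{(\alpha_1,\ldots,\alpha_{i-1},g_s^i\alpha_i,\alpha_{i+1},\ldots,\alpha_k)},$$ where $\boldsymbol\lambda_{i,j}(s,g^j_{j_1}\cdots g^j_{j_q})=\prod_{b=1}^q\lambda_{i,j}(s,j_b)$, $\boldsymbol\lambda_{i,j}(s,g_0^j)=1$ (no factor if $i=1$). $\mathcal K$ is a Hilbert space, $P_{\mathcal M}$ is the orthogonal projection onto the closed subspace $\mathcal M$, and $\Phi_{S_i\otimes I_{\mathcal K}}(X):=\sum_{s=1}^{n_i}(S_{i,s}\otimes I_{\mathcal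 K})X(S_{i,s}\otimes I_{\mathcal K})^*$. $(S_i\otimes I_{\mathcal K})|_{\mathcal M}$ is the row $[(S_{i,1}\otimes I_{\mathcal K})|_{\mathcal M}\cdots(S_{i,n_i}\otimes I_{\mathcal K})|_{\mathcal M}]$ of operators on $\mathcal M$. A $k$-tuple of row isometries $V_i=[V_{i,1}\cdots V_{i,n_i}]$ on a Hilbert space is doubly $\Lambda$-commuting if $V_{i,s}^*V_{j,t}=\overline{\lambda_{i,j}(s,t)}V_{j,t}V_{i,s}^*$ for all $i\ne j$, $s,t$. A bounded operator $A:\ell^2(\mathbb F_{n_1}^+\times\cdots\times\mathbb F_{n_k}^+)\otimes\mathcal L\to\ell^2(\mathbb F_{n_1}^+\times\cdots\times\mathbb F_{n_k}^+)\otimes\mathcal K$ is multi-analytic if $A(S_{i,s}\otimes I_{\mathcal L})=(S_{i,s}\otimes I_{\mathcal K})A$ for all $i,s$; it is inner multi-analytic if moreover it is a partial isometry. $\mathcal M$ is a Beurling type jointly invariant subspace if $\mathcal M=\Psi(\ell^2(\mathbb F_{n_1}^+\times\cdots\times\mathbb F_{n_k}^+)\otimes\mathcal L)$ for some Hilbert space $\mathcal L$ and some inner multi-analytic operator $\Psi$. *)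

theory Defs
  imports "HOL-Analysis.Analysis" "HOL-Library.Nonpos_Ints"
begin

section \<open>Complex Hilbert spaces\<close>

text \<open>
  The complex inner product is linear in the first argument; its real part is the
  library's real inner product, so that norm and topology are the library's.
\<close>

class complex_inner = real_inner +
  fixes scaleC :: "complex \<Rightarrow> 'a \<Rightarrow> 'a"  (infixr "*\<^sub>C" 75)
    and cinner :: "'a \<Rightarrow> 'a \<Rightarrow> complex"
  assumes scaleC_add_right: "a *\<^sub>C (x + y) = a *\<^sub>C x + a *\<^sub>C y"
    and scaleC_add_left: "(a + b) *\<^sub>C x = a *\<^sub>C x + b *\<^sub>C x"
    and scaleC_scaleC: "a *\<^sub>C (b *\<^sub>C x) = (a * b) *\<^sub>C x"
    and scaleR_scaleC: "r *\<^sub>R x = complex_of_real r *\<^sub>C x"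
    and cinner_commute: "cinner x y = cnj (cinner y x)"
    and cinner_add_left: "cinner (x + y) z = cinner x z + cinner y z"
    and cinner_scaleC_left: "cinner (a *\<^sub>C x) y = a * cinner x y"
    and Re_cinner: "Re (cinner x y) = inner x y"

class chilbert_space = complex_inner + complete_space

instantiation complex :: chilbert_space
begin
definition scaleC_complex :: "complex \<Rightarrow> complex \<Rightarrow> complex" where
  "scaleC_complex a x = a * x"
definition cinner_complex :: "complex \<Rightarrow> complex \<Rightarrow> complex" where
  "cinner_complex x y = x * cnj y"
instance
  by standard (auto simp: scaleC_complex_def cinner_complex_def inner_complex_def
      algebra_simps scaleR_conv_of_real)
end

lemma scaleC_one [simp]: "1 *\<^sub>C (x :: 'a::complex_inner) = x"
  using scaleR_scaleC[of 1 x] by simp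

lemma scaleC_zero_left [simp]: "0 *\<^sub>C (x :: 'a::complex_inner) = 0"
  using scaleR_scaleC[of 0 x] by simp

lemma scaleC_zero_right [simp]: "a *\<^sub>C (0 :: 'a::complex_inner) = 0"
  using scaleC_add_right[of a 0 "0 :: 'a"] by simp

lemma cinner_scaleC_right: "cinner (x :: 'a::complex_inner) (a *\<^sub>C y) = cnj a * cinner x y"
  by (metis cinner_commute cinner_scaleC_left complex_cnj_mult)

lemma cinner_zero_left [simp]: "cinner 0 (x :: 'a::complex_inner) = 0"
  using cinner_scaleC_left[of 0 "0 :: 'a" x] by simp

lemma cinner_zero_right [simp]: "cinner (x :: 'a::complex_inner) 0 = 0"
  using cinner_commute[of x 0] by simp

lemma cinner_self: "cinner (x :: 'a::complex_inner) x = complex_of_real ((norm x)\<^sup>2)"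
proof (rule complex_eqI)
  have "Im (cinner x x) = - Im (cinner x x)"
    using cinner_commute[of x x] by (metis cnj.sel(2))
  then show "Im (cinner x x) = Im (complex_of_real ((norm x)\<^sup>2))" by simp
qed (simp add: Re_cinner power2_norm_eq_inner)

lemma norm_scaleC: "norm (a *\<^sub>C (x :: 'a::complex_inner)) = cmod a * norm x"
proof -
  have "complex_of_real ((norm (a *\<^sub>C x))\<^sup>2) = (a * cnj a) * cinner x x"
    by (simp only: cinner_self[symmetric] cinner_scaleC_left cinner_scaleC_right mult_ac)
  also have "\<dots> = complex_of_real ((cmod a * norm x)\<^sup>2)"
    by (simp add: cinner_self power_mult_distrib complex_norm_square[symmetric])
  finally have "complex_of_real ((norm (a *\<^sub>C x))\<^sup>2) = complex_of_real ((cmod a * norm x)\<^sup>2)" .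
  then have "(norm (a *\<^sub>C x))\<^sup>2 = (cmod a * norm x)\<^sup>2"
    by (simp only: of_real_eq_iff)
  then show ?thesis by (simp add: power2_eq_iff_nonneg)
qed

lemma cinner_Cauchy_Schwarz: "cmod (cinner (x :: 'a::complex_inner) y) \<le> norm x * norm y"
proof (cases "cinner x y = 0")
  case False
  define u where "u = cnj (cinner x y) / cmod (cinner x y)"
  have u: "cmod u = 1" using False by (simp add: u_def norm_divide)
  have "u * cinner x y = complex_of_real (cmod (cinner x y))"
    using False by (simp add: u_def complex_norm_square[symmetric] mult.commute power2_eq_square)
  then have "cmod (cinner x y) = Re (cinner (u *\<^sub>C x) y)"
    by (simp add: cinner_scaleC_left)
  also have "\<dots> \<le> norm (u *\<^sub>C x) * norm y"
    by (simp add: Re_cinner norm_cauchy_schwarz)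
  finally show ?thesis by (simp add: norm_scaleC u)
qed simp

definition closed_csubspace :: "'a::complex_inner set \<Rightarrow> bool" where
  "closed_csubspace M \<longleftrightarrow> closed M \<and> 0 \<in> M \<and> (\<forall>x\<in>M. \<forall>y\<in>M. x + y \<in> M) \<and> (\<forall>a. \<forall>x\<in>M. a *\<^sub>C x \<in> M)"


section \<open>Bounded operators between closed subspaces\<close>

text \<open>
  A Hilbert space is presented as a closed subspace of a type of class \<^class>\<open>chilbert_space\<close>
  (possibly the whole type), an operator between two such spaces as a function on the ambient
  types of which only the values on the domain matter.
\<close>

definition bounded_op :: "'a::complex_inner set \<Rightarrow> 'b::complex_inner set \<Rightarrow> ('a \<Rightarrow> 'b) \<Rightarrow> bool" where
  "bounded_op H H' A \<longleftrightarrow> A ` H \<subseteq> H' \<and>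
     (\<forall>x\<in>H. \<forall>y\<in>H. A (x + y) = A x + A y) \<and> (\<forall>a. \<forall>x\<in>H. A (a *\<^sub>C x) = a *\<^sub>C A x) \<and>
     (\<exists>C. \<forall>x\<in>H. norm (A x) \<le> C * norm x)"

definition adjoint_on :: "'a::complex_inner set \<Rightarrow> ('a \<Rightarrow> 'b::complex_inner) \<Rightarrow> 'b \<Rightarrow> 'a" where
  "adjoint_on H A y = (THE x. x \<in> H \<and> (\<forall>z\<in>H. cinner (A z) y = cinner z x))"

definition orth_proj :: "'a::complex_inner set \<Rightarrow> 'a \<Rightarrow> 'a" where
  "orth_proj M x = (THE y. y \<in> M \<and> (\<forall>z\<in>M. cinner (x - y) z = 0))"

definition positive_op :: "'a::complex_inner set \<Rightarrow> ('a \<Rightarrow> 'a) \<Rightarrow> bool" where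
  "positive_op H T \<longleftrightarrow> (\<forall>x\<in>H. cinner (T x) x \<in> \<real>\<^sub>\<ge>\<^sub>0)"

definition isometry_on :: "'a::complex_inner set \<Rightarrow> ('a \<Rightarrow> 'b::complex_inner) \<Rightarrow> bool" where
  "isometry_on H A \<longleftrightarrow> (\<forall>x\<in>H. norm (A x) = norm x)"

definition partial_isometry_on :: "'a::complex_inner set \<Rightarrow> ('a \<Rightarrow> 'b::complex_inner) \<Rightarrow> bool" where
  "partial_isometry_on H A \<longleftrightarrow>
     (\<forall>x\<in>H. (\<forall>y\<in>H. A y = 0 \<longrightarrow> cinner x y = 0) \<longrightarrow> norm (A x) = norm x)"

text \<open>The row \<open>[V 1 \<dots> V m]\<close> is an isometry from the direct sum of \<open>m\<close> copies of \<open>H\<close> into \<open>H\<close>.\<close>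

definition row_isometry :: "'a::complex_inner set \<Rightarrow> nat \<Rightarrow> (nat \<Rightarrow> 'a \<Rightarrow> 'a) \<Rightarrow> bool" where
  "row_isometry H m V \<longleftrightarrow> (\<forall>s\<in>{1..m}. bounded_op H H (V s)) \<and>
     (\<forall>x. (\<forall>s\<in>{1..m}. x s \<in> H) \<longrightarrow>
        (norm (\<Sum>s = 1..m. V s (x s)))\<^sup>2 = (\<Sum>s = 1..m. (norm (x s))\<^sup>2))"


section \<open>Square-summable families in a Hilbert space\<close>

lemma norm_add_sq_le: "(norm (x + y :: 'a::real_inner))\<^sup>2 \<le> 2 * (norm x)\<^sup>2 + 2 * (norm y)\<^sup>2"
proof -
  have "(norm (x + y))\<^sup>2 + (norm (x - y))\<^sup>2 = 2 * (norm x)\<^sup>2 + 2 * (norm y)\<^sup>2"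
    by (simp add: power2_norm_eq_inner inner_add_left inner_add_right inner_diff_left
        inner_diff_right)
  then show ?thesis using zero_le_power2[of "norm (x - y)"] by linarith
qed

typedef (overloaded) ('x, 'a::complex_inner) l2 =
  "{f :: 'x \<Rightarrow> 'a. (\<lambda>u. (norm (f u))\<^sup>2) summable_on UNIV}"
  morphisms l2_apply Abs_l2
  by (rule exI[of _ "\<lambda>_. 0"]) simp

setup_lifting type_definition_l2

lemma l2_eqI: "(\<And>u. l2_apply f u = l2_apply g u) \<Longrightarrow> f = g"
  by (metis ext l2_apply_inject)

lemma l2_summable: "(\<lambda>u. (norm (l2_apply f u))\<^sup>2) summable_on A"
  using l2_apply[of f] summable_on_subset_banach by fastforce

lemma l2_cinner_abs_summable: "(\<lambda>u. cmod (cinner (l2_apply f u) (l2_apply g u))) summable_on A"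
proof (rule summable_on_comparison_test)
  show "(\<lambda>u. (norm (l2_apply f u))\<^sup>2 + (norm (l2_apply g u))\<^sup>2) summable_on A"
    by (intro summable_on_add l2_summable)
  show "cmod (cinner (l2_apply f u) (l2_apply g u)) \<le> (norm (l2_apply f u))\<^sup>2 + (norm (l2_apply g u))\<^sup>2" for u
  proof -
    have "cmod (cinner (l2_apply f u) (l2_apply g u)) \<le> norm (l2_apply f u) * norm (l2_apply g u)"
      by (rule cinner_Cauchy_Schwarz)
    also have "\<dots> \<le> (norm (l2_apply f u))\<^sup>2 + (norm (l2_apply g u))\<^sup>2"
      using sum_squares_bound[of "norm (l2_apply f u)" "norm (l2_apply g u)"]
        mult_nonneg_nonneg[OF norm_ge_zero[of "l2_apply f u"] norm_ge_zero[of "l2_apply g u"]]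
      by linarith
    finally show ?thesis .
  qed
qed simp

lemmas l2_cinner_summable = abs_summable_summable[OF l2_cinner_abs_summable]

lemma l2_inner_summable: "(\<lambda>u. inner (l2_apply f u) (l2_apply g u)) summable_on A"
  using summable_on_Re[OF l2_cinner_summable[of f g A]] by (simp add: Re_cinner)

instantiation l2 :: (type, complex_inner) complex_inner
begin

lift_definition zero_l2 :: "('a, 'b) l2" is "\<lambda>_. 0" by simp

lift_definition plus_l2 :: "('a, 'b) l2 \<Rightarrow> ('a, 'b) l2 \<Rightarrow> ('a, 'b) l2" is "\<lambda>f g u. f u + g u"
proof -
  fix f g :: "'a \<Rightarrow> 'b"
  assume "(\<lambda>u. (norm (f u))\<^sup>2) summable_on UNIV" "(\<lambda>u. (norm (g u))\<^sup>2) summable_on UNIV"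
  then have "(\<lambda>u. 2 * (norm (f u))\<^sup>2 + 2 * (norm (g u))\<^sup>2) summable_on UNIV"
    by (intro summable_on_add summable_on_cmult_right)
  then show "(\<lambda>u. (norm (f u + g u))\<^sup>2) summable_on UNIV"
    by (rule summable_on_comparison_test) (auto intro: norm_add_sq_le)
qed

lift_definition uminus_l2 :: "('a, 'b) l2 \<Rightarrow> ('a, 'b) l2" is "\<lambda>f u. - f u" by simp

definition minus_l2 :: "('a, 'b) l2 \<Rightarrow> ('a, 'b) l2 \<Rightarrow> ('a, 'b) l2" where
  "minus_l2 f g = f + - g"

lift_definition scaleC_l2 :: "complex \<Rightarrow> ('a, 'b) l2 \<Rightarrow> ('a, 'b) l2" is "\<lambda>a f u. a *\<^sub>C f u"
  by (simp add: norm_scaleC power_mult_distrib summable_on_cmult_right)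

definition scaleR_l2 :: "real \<Rightarrow> ('a, 'b) l2 \<Rightarrow> ('a, 'b) l2" where
  "scaleR_l2 r f = complex_of_real r *\<^sub>C f"

definition cinner_l2 :: "('a, 'b) l2 \<Rightarrow> ('a, 'b) l2 \<Rightarrow> complex" where
  "cinner_l2 f g = (\<Sum>\<^sub>\<infinity>u. cinner (l2_apply f u) (l2_apply g u))"

definition inner_l2 :: "('a, 'b) l2 \<Rightarrow> ('a, 'b) l2 \<Rightarrow> real" where
  "inner_l2 f g = (\<Sum>\<^sub>\<infinity>u. inner (l2_apply f u) (l2_apply g u))"

definition norm_l2 :: "('a, 'b) l2 \<Rightarrow> real" where
  "norm_l2 f = sqrt (inner f f)"

definition sgn_l2 :: "('a, 'b) l2 \<Rightarrow> ('a, 'b) l2" where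
  "sgn_l2 f = scaleR (inverse (norm f)) f"

definition dist_l2 :: "('a, 'b) l2 \<Rightarrow> ('a, 'b) l2 \<Rightarrow> real" where
  "dist_l2 f g = norm (f - g)"

definition uniformity_l2 :: "(('a, 'b) l2 \<times> ('a, 'b) l2) filter" where
  "uniformity_l2 = (INF e\<in>{0<..}. principal {(x, y). dist x y < e})"

definition open_l2 :: "('a, 'b) l2 set \<Rightarrow> bool" where
  "open_l2 U \<longleftrightarrow> (\<forall>x\<in>U. eventually (\<lambda>(x', y). x' = x \<longrightarrow> y \<in> U) uniformity)"

lemma l2_apply_simps [simp]:
  "l2_apply (0 :: ('a, 'b) l2) u = 0"
  "l2_apply (f + g :: ('a, 'b) l2) u = l2_apply f u + l2_apply g u"
  "l2_apply (- f :: ('a, 'b) l2) u = - l2_apply f u"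
  "l2_apply (f - g :: ('a, 'b) l2) u = l2_apply f u - l2_apply g u"
  "l2_apply (a *\<^sub>C f :: ('a, 'b) l2) u = a *\<^sub>C l2_apply f u"
  "l2_apply (r *\<^sub>R f :: ('a, 'b) l2) u = r *\<^sub>R l2_apply f u"
  by (simp_all add: zero_l2.rep_eq plus_l2.rep_eq uminus_l2.rep_eq scaleC_l2.rep_eq
      minus_l2_def scaleR_l2_def scaleR_scaleC)

instance
proof
  fix f g h :: "('a, 'b) l2" and a b :: complex and r s :: real
  show "f + g + h = f + (g + h)" "f + g = g + f" "0 + f = f" "- f + f = 0" "f - g = f + - g"
    "r *\<^sub>R (f + g) = r *\<^sub>R f + r *\<^sub>R g" "(r + s) *\<^sub>R f = r *\<^sub>R f + s *\<^sub>R f"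
    "r *\<^sub>R s *\<^sub>R f = (r * s) *\<^sub>R f" "1 *\<^sub>R f = f"
    "a *\<^sub>C (f + g) = a *\<^sub>C f + a *\<^sub>C g" "(a + b) *\<^sub>C f = a *\<^sub>C f + b *\<^sub>C f"
    "a *\<^sub>C b *\<^sub>C f = (a * b) *\<^sub>C f"
    by (auto intro!: l2_eqI simp: algebra_simps scaleC_add_left scaleC_add_right scaleC_scaleC)
  show "r *\<^sub>R f = complex_of_real r *\<^sub>C f" by (rule scaleR_l2_def)
  show "sgn f = scaleR (inverse (norm f)) f" by (rule sgn_l2_def)
  show "dist f g = norm (f - g)" by (rule dist_l2_def)
  show "uniformity = (INF e\<in>{0<..}. principal {(x :: ('a, 'b) l2, y). dist x y < e})"
    by (rule uniformity_l2_def)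
  show "open U = (\<forall>x\<in>U. \<forall>\<^sub>F (x', y) in uniformity. x' = x \<longrightarrow> y \<in> U)" for U :: "('a, 'b) l2 set"
    by (rule open_l2_def)
  show "norm f = sqrt (inner f f)" by (rule norm_l2_def)
  show "inner f g = inner g f" by (simp add: inner_l2_def inner_commute)
  show "inner (f + g) h = inner f h + inner g h"
    by (simp add: inner_l2_def inner_add_left infsum_add l2_inner_summable)
  show "inner (r *\<^sub>R f) g = r * inner f g"
    by (simp add: inner_l2_def infsum_cmult_right l2_inner_summable)
  show "0 \<le> inner f f" by (simp add: inner_l2_def infsum_nonneg)
  show "inner f f = 0 \<longleftrightarrow> f = 0"
  proof
    assume "inner f f = 0"
    then have "inner (l2_apply f u) (l2_apply f u) = 0" for u
      using nonneg_infsum_le_0D[of "\<lambda>u. inner (l2_apply f u) (l2_apply f u)" UNIV u]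
        l2_inner_summable[of f f UNIV] by (simp add: inner_l2_def)
    then show "f = 0" by (auto intro!: l2_eqI)
  qed (simp add: inner_l2_def)
  show "cinner f g = cnj (cinner g f)"
    unfolding cinner_l2_def infsum_cnj[symmetric] by (rule infsum_cong) (rule cinner_commute)
  show "cinner (f + g) h = cinner f h + cinner g h"
    by (simp add: cinner_l2_def cinner_add_left infsum_add l2_cinner_summable)
  show "cinner (a *\<^sub>C f) g = a * cinner f g"
    by (simp add: cinner_l2_def cinner_scaleC_left infsum_cmult_right l2_cinner_summable)
  show "Re (cinner f g) = inner f g"
    using infsum_Re[OF l2_cinner_summable[of f g UNIV]]
    by (simp add: cinner_l2_def inner_l2_def Re_cinner)
qed

end

lemma norm_l2_sq: "(norm (f :: ('x, 'a::complex_inner) l2))\<^sup>2 = (\<Sum>\<^sub>\<infinity>u. (norm (l2_apply f u))\<^sup>2)"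
  by (simp add: power2_norm_eq_inner) (simp add: inner_l2_def power2_norm_eq_inner)

lemma sum_norm_l2_le:
  "finite F \<Longrightarrow> (\<Sum>u\<in>F. (norm (l2_apply f u))\<^sup>2) \<le> (norm (f :: ('x, 'a::complex_inner) l2))\<^sup>2"
  unfolding norm_l2_sq by (rule finite_sum_le_infsum) (auto simp: l2_summable)

lemma norm_l2_apply_le: "norm (l2_apply f u) \<le> norm (f :: ('x, 'a::complex_inner) l2)"
  using sum_norm_l2_le[of "{u}" f] by (simp add: power2_le_iff_abs_le)

instance l2 :: (type, chilbert_space) chilbert_space
proof
  fix X :: "nat \<Rightarrow> ('a, 'b) l2"
  assume X: "Cauchy X"
  have "Cauchy (\<lambda>m. l2_apply (X m) u)" for u
  proof (rule metric_CauchyI)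
    fix e :: real assume "e > 0"
    then obtain N where "\<forall>m\<ge>N. \<forall>n\<ge>N. dist (X m) (X n) < e" using X by (metis metric_CauchyD)
    moreover have "dist (l2_apply (X m) u) (l2_apply (X n) u) \<le> dist (X m) (X n)" for m n
      using norm_l2_apply_le[of "X m - X n" u] by (simp add: dist_norm)
    ultimately have "\<forall>m\<ge>N. \<forall>n\<ge>N. dist (l2_apply (X m) u) (l2_apply (X n) u) < e"
      by (meson le_less_trans)
    then show "\<exists>N. \<forall>m\<ge>N. \<forall>n\<ge>N. dist (l2_apply (X m) u) (l2_apply (X n) u) < e" by blast
  qed
  then have "\<exists>l. (\<lambda>m. l2_apply (X m) u) \<longlonglongrightarrow> l" for u
    by (simp add: Cauchy_convergent convergent_def[symmetric])
  then obtain g where g: "\<And>u. (\<lambda>m. l2_apply (X m) u) \<longlonglongrightarrow> g u" by metis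
  have tail: "(\<Sum>u\<in>F. (norm (l2_apply (X n) u - g u))\<^sup>2) \<le> e\<^sup>2"
    if "finite F" and e: "\<forall>m\<ge>N. dist (X n) (X m) < e" for F e n N
  proof (rule tendsto_upperbound[OF _ _ sequentially_bot])
    show "(\<lambda>m. \<Sum>u\<in>F. (norm (l2_apply (X n) u - l2_apply (X m) u))\<^sup>2)
      \<longlonglongrightarrow> (\<Sum>u\<in>F. (norm (l2_apply (X n) u - g u))\<^sup>2)"
      by (intro tendsto_intros g)
    have "(\<Sum>u\<in>F. (norm (l2_apply (X n) u - l2_apply (X m) u))\<^sup>2) \<le> e\<^sup>2" if "m \<ge> N" for m
    proof -
      have "(\<Sum>u\<in>F. (norm (l2_apply (X n - X m) u))\<^sup>2) \<le> (norm (X n - X m))\<^sup>2"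
        by (rule sum_norm_l2_le) fact
      also have "\<dots> \<le> e\<^sup>2" using e that
        by (intro power_mono) (auto simp: dist_norm less_imp_le)
      finally show ?thesis by simp
    qed
    then show "\<forall>\<^sub>F m in sequentially.
        (\<Sum>u\<in>F. (norm (l2_apply (X n) u - l2_apply (X m) u))\<^sup>2) \<le> e\<^sup>2"
      using eventually_sequentially by blast
  qed
  have sum: "(\<lambda>u. (norm (l2_apply (X n) u - g u))\<^sup>2) summable_on UNIV"
    if "\<forall>m\<ge>N. dist (X n) (X m) < e" for e n N
  proof (rule nonneg_bdd_above_summable_on)
    show "bdd_above (sum (\<lambda>u. (norm (l2_apply (X n) u - g u))\<^sup>2) ` {F. F \<subseteq> UNIV \<and> finite F})"
      by (rule bdd_aboveI2[of _ _ "e\<^sup>2"]) (blast intro: tail[OF _ that])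
  qed simp
  obtain N1 where N1: "\<forall>m\<ge>N1. dist (X N1) (X m) < 1"
    using X metric_CauchyD[of X 1] by auto
  have "(\<lambda>u. 2 * (norm (l2_apply (X N1) u))\<^sup>2 + 2 * (norm (l2_apply (X N1) u - g u))\<^sup>2) summable_on UNIV"
    by (intro summable_on_add summable_on_cmult_right l2_summable sum[OF N1])
  then have "(\<lambda>u. (norm (g u))\<^sup>2) summable_on UNIV"
  proof (rule summable_on_comparison_test)
    show "(norm (g u))\<^sup>2 \<le> 2 * (norm (l2_apply (X N1) u))\<^sup>2 + 2 * (norm (l2_apply (X N1) u - g u))\<^sup>2" for u
      using norm_add_sq_le[of "l2_apply (X N1) u" "g u - l2_apply (X N1) u"]
      by (simp add: norm_minus_commute)
  qed simp
  then have G: "l2_apply (Abs_l2 g) = g" by (simp add: Abs_l2_inverse)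
  have "X \<longlonglongrightarrow> Abs_l2 g"
  proof (rule metric_LIMSEQ_I)
    fix r :: real assume "r > 0"
    then obtain N where N: "\<forall>m\<ge>N. \<forall>n\<ge>N. dist (X m) (X n) < r / 2"
      using X metric_CauchyD[of X "r / 2"] by auto
    have "dist (X n) (Abs_l2 g) < r" if "n \<ge> N" for n
    proof -
      have *: "\<forall>m\<ge>N. dist (X n) (X m) < r / 2" using N that by blast
      have "(norm (X n - Abs_l2 g))\<^sup>2 \<le> (r / 2)\<^sup>2"
        unfolding norm_l2_sq by (rule infsum_le_finite_sums) (simp_all add: G sum[OF *] tail[OF _ *])
      then have "norm (X n - Abs_l2 g) \<le> r / 2"
        by (rule power2_le_imp_le) (use \<open>r > 0\<close> in simp)
      then show ?thesis using \<open>r > 0\<close> by (simp add: dist_norm)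
    qed
    then show "\<exists>N. \<forall>n\<ge>N. dist (X n) (Abs_l2 g) < r" by blast
  qed
  then show "convergent X" by (rule convergentI)
qed


section \<open>The Hilbert tensor product \<open>\<ell>\<^sup>2(X) \<otimes> L\<close>\<close>

text \<open>
  \<open>\<ell>\<^sup>2(X) \<otimes> L\<close> is realised as the space of square-summable families in \<open>L\<close> indexed by \<open>X\<close>,
  extended by zero to the whole index type; \<open>f \<otimes> x\<close> is the family \<open>u \<mapsto> f(u) x\<close>. That this is the
  Hilbert tensor product is the content of \<open>cinner_tensor\<close> and \<open>l2_tensor_eq_closure\<close> below.
  In particular \<open>\<ell>\<^sup>2(X)\<close> itself is \<open>l2_tensor X (UNIV :: complex set)\<close>.
\<close>

definition l2_tensor :: "'x set \<Rightarrow> 'a::complex_inner set \<Rightarrow> ('x, 'a) l2 set" where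
  "l2_tensor X L = {f. (\<forall>u. l2_apply f u \<in> L) \<and> (\<forall>u. u \<notin> X \<longrightarrow> l2_apply f u = 0)}"

lift_definition tensor :: "('x, complex) l2 \<Rightarrow> 'a::complex_inner \<Rightarrow> ('x, 'a) l2"
  is "\<lambda>f x u. f u *\<^sub>C x"
  by (simp add: norm_scaleC power_mult_distrib summable_on_cmult_left)

lift_definition chi :: "'x \<Rightarrow> ('x, complex) l2" is "\<lambda>u v. if v = u then 1 else 0"
proof -
  fix u :: 'x
  have "(\<lambda>v. (norm (if v = u then 1 else 0 :: complex))\<^sup>2) summable_on {u}" by simp
  then show "(\<lambda>v. (norm (if v = u then 1 else 0 :: complex))\<^sup>2) summable_on UNIV"
    by (rule summable_on_cong_neutral[THEN iffD1, rotated -1]) auto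
qed

lemma l2_apply_tensor [simp]: "l2_apply (tensor f x) u = l2_apply f u *\<^sub>C x"
  by (simp add: tensor.rep_eq)

lemma l2_apply_chi [simp]: "l2_apply (chi u) v = (if v = u then 1 else 0)"
  by (simp add: chi.rep_eq)

lemma cinner_tensor: "cinner (tensor f x) (tensor g y) = cinner f g * cinner x y"
proof -
  have "cinner (tensor f x) (tensor g y) =
      (\<Sum>\<^sub>\<infinity>u. cinner (l2_apply f u) (l2_apply g u) * cinner x y)"
    unfolding cinner_l2_def
    by (simp add: cinner_scaleC_left cinner_scaleC_right cinner_complex_def mult_ac)
  also have "\<dots> = cinner f g * cinner x y"
    unfolding cinner_l2_def by (rule infsum_cmult_left) (rule l2_cinner_summable)
  finally show ?thesis .
qed

lemma bounded_linear_l2_apply: "bounded_linear (\<lambda>f :: ('x, 'a::complex_inner) l2. l2_apply f u)"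
  by (rule bounded_linear_intro[where K = 1]) (auto simp: norm_l2_apply_le)

lemma closed_csubspace_l2_tensor:
  fixes X :: "'x set" and L :: "'a::complex_inner set"
  assumes "closed_csubspace L"
  shows "closed_csubspace (l2_tensor X L)"
proof -
  have "l2_tensor X L = (\<Inter>u. (\<lambda>f. l2_apply f u) -` L) \<inter>
      (\<Inter>u\<in>- X. (\<lambda>f. l2_apply f u) -` {0})"
    by (auto simp: l2_tensor_def)
  moreover have "closed ((\<lambda>f. l2_apply f u) -` C)" if "closed C" for u :: 'x and C :: "'a set"
    using that by (intro closed_vimage linear_continuous_on bounded_linear_l2_apply) auto
  ultimately have "closed (l2_tensor X L)"
    using assms by (auto simp: closed_csubspace_def intro!: closed_Int closed_INT)
  then show ?thesis using assms by (auto simp: closed_csubspace_def l2_tensor_def)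
qed

lemma l2_tensor_eq_closure:
  fixes X :: "'x set" and L :: "'a::complex_inner set"
  assumes L: "closed_csubspace L"
  shows "l2_tensor X L = closure (span {tensor f x | f x. f \<in> l2_tensor X UNIV \<and> x \<in> L})"
    (is "_ = closure (span ?T)")
proof
  have sub: "closed_csubspace (l2_tensor X L)" by (rule closed_csubspace_l2_tensor[OF L])
  have "?T \<subseteq> l2_tensor X L" using L by (auto simp: l2_tensor_def closed_csubspace_def)
  moreover have "subspace (l2_tensor X L)"
    using sub by (auto simp: closed_csubspace_def subspace_def scaleR_scaleC)
  ultimately show "closure (span ?T) \<subseteq> l2_tensor X L"
    using sub by (intro closure_minimal span_minimal) (auto simp: closed_csubspace_def)
  show "l2_tensor X L \<subseteq> closure (span ?T)"
  proof
    fix g assume g: "g \<in> l2_tensor X L"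
    let ?q = "\<lambda>u. (norm (l2_apply g u))\<^sup>2"
    have "\<exists>h\<in>span ?T. dist h g < e" if "e > 0" for e
    proof -
      have "((\<lambda>F. sum ?q F) \<longlongrightarrow> infsum ?q UNIV) (finite_subsets_at_top UNIV)"
        using has_sum_infsum[OF l2_summable[of g UNIV]] by (simp add: has_sum_def)
      moreover have "infsum ?q UNIV - e\<^sup>2 < infsum ?q UNIV" using that by simp
      ultimately have "\<forall>\<^sub>F F in finite_subsets_at_top UNIV. infsum ?q UNIV - e\<^sup>2 < sum ?q F"
        by (rule order_tendstoD)
      then obtain F where F: "finite F" "infsum ?q UNIV - e\<^sup>2 < sum ?q F"
        by (auto simp: eventually_finite_subsets_at_top)
      define h where "h = (\<Sum>u\<in>F \<inter> X. tensor (chi u) (l2_apply g u))"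
      have "tensor (chi u) (l2_apply g u) \<in> ?T" if "u \<in> X" for u
        using that g by (auto simp: l2_tensor_def intro!: exI[of _ "chi u"])
      then have "h \<in> span ?T" unfolding h_def by (intro span_sum span_base) auto
      have h: "l2_apply h u = (if u \<in> F then l2_apply g u else 0)" for u
      proof -
        have "l2_apply h u = (\<Sum>v\<in>F \<inter> X. l2_apply (tensor (chi v) (l2_apply g v)) u)"
          unfolding h_def by (rule bounded_linear.linear[OF bounded_linear_l2_apply, THEN linear_sum])
        also have "\<dots> = (\<Sum>v\<in>F \<inter> X. if u = v then l2_apply g v else 0)"
          by (intro sum.cong) auto
        also have "\<dots> = (if u \<in> F then l2_apply g u else 0)"
          using F(1) g by (auto simp: l2_tensor_def)
        finally show ?thesis .
      qed
      have "(norm (h - g))\<^sup>2 = infsum (\<lambda>u. if u \<in> F then 0 else ?q u) UNIV"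
        unfolding norm_l2_sq by (rule infsum_cong) (simp add: h)
      also have "\<dots> = infsum ?q (UNIV - F)"
        by (rule infsum_cong_neutral) auto
      also have "\<dots> = infsum ?q UNIV - infsum ?q F"
        by (rule infsum_Diff) (auto simp: l2_summable)
      also have "\<dots> < e\<^sup>2" using F by simp
      finally have "norm (h - g) < e"
        by (rule power2_less_imp_less) (use that in simp)
      then show ?thesis using \<open>h \<in> span ?T\<close> by (auto simp: dist_norm)
    qed
    then show "g \<in> closure (span ?T)" by (simp add: closure_approachable)
  qed
qed


section \<open>The universal model\<close>

text \<open>
  A generator \<open>g\<^sub>s\<^sup>i\<close> is encoded by the number \<open>s \<in> {1..n i}\<close>, a word by the list of its letters and
  \<open>(\<alpha>\<^sub>1, \<dots>, \<alpha>\<^sub>k)\<close> by a function on \<open>{1..k}\<close>. The entry \<open>\<lambda>\<^sub>i\<^sub>,\<^sub>j(s,t)\<close> is \<open>lam i j s t\<close>; values of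
  \<open>lam\<close> outside the given index ranges are irrelevant.
\<close>

type_synonym words = "nat \<Rightarrow> nat list"

definition Words :: "nat \<Rightarrow> (nat \<Rightarrow> nat) \<Rightarrow> words set" where
  "Words k n = (\<Pi>\<^sub>E i\<in>{1..k}. lists {1..n i})"

definition Lambda_system :: "nat \<Rightarrow> (nat \<Rightarrow> nat) \<Rightarrow> (nat \<Rightarrow> nat \<Rightarrow> nat \<Rightarrow> nat \<Rightarrow> complex) \<Rightarrow> bool" where
  "Lambda_system k n lam \<longleftrightarrow>
     (\<forall>i\<in>{1..k}. \<forall>j\<in>{1..k}. i \<noteq> j \<longrightarrow> (\<forall>s\<in>{1..n i}. \<forall>t\<in>{1..n j}.
        cmod (lam i j s t) = 1 \<and> lam j i t s = cnj (lam i j s t)))"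

definition phase :: "(nat \<Rightarrow> nat \<Rightarrow> nat \<Rightarrow> nat \<Rightarrow> complex) \<Rightarrow> nat \<Rightarrow> nat \<Rightarrow> words \<Rightarrow> complex" where
  "phase lam i s \<alpha> = (\<Prod>j\<in>{1..<i}. \<Prod>t\<leftarrow>\<alpha> j. lam i j s t)"

text \<open>
  \<open>shift k n lam i s\<close> is \<open>S\<^sub>i\<^sub>,\<^sub>s \<otimes> I\<close> on \<open>\<ell>\<^sup>2 \<otimes> K\<close>, and \<open>S\<^sub>i\<^sub>,\<^sub>s\<close> itself when \<open>K = \<complex>\<close>. The definition gives the
  coefficients of the image; the action on the basis vectors is \<open>shift_chi\<close> and
  \<open>shift_tensor\<close> says \<open>(S\<^sub>i\<^sub>,\<^sub>s \<otimes> I)(f \<otimes> x) = S\<^sub>i\<^sub>,\<^sub>s f \<otimes> x\<close>.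
\<close>

definition shift :: "nat \<Rightarrow> (nat \<Rightarrow> nat) \<Rightarrow> (nat \<Rightarrow> nat \<Rightarrow> nat \<Rightarrow> nat \<Rightarrow> complex) \<Rightarrow> nat \<Rightarrow> nat \<Rightarrow>
    (words, 'a::complex_inner) l2 \<Rightarrow> (words, 'a) l2" where
  "shift k n lam i s f = Abs_l2 (\<lambda>\<beta>.
     if \<beta> \<in> Words k n \<and> (\<exists>w. \<beta> i = s # w)
     then phase lam i s \<beta> *\<^sub>C l2_apply f (\<beta>(i := tl (\<beta> i))) else 0)"

lemma phase_fun_upd [simp]: "phase lam i s (\<alpha>(i := w)) = phase lam i s \<alpha>"
  by (simp add: phase_def)

lemma cmod_phase:
  assumes "Lambda_system k n lam" "i \<in> {1..k}" "s \<in> {1..n i}" "\<alpha> \<in> Words k n"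
  shows "cmod (phase lam i s \<alpha>) = 1"
proof -
  have "cmod (\<Prod>t\<leftarrow>w. lam i j s t) = 1" if "j \<in> {1..<i}" "w \<in> lists {1..n j}" for j w
  proof -
    have "j \<in> {1..k}" "i \<noteq> j" using assms(2) that(1) by auto
    then have "\<forall>t\<in>{1..n j}. cmod (lam i j s t) = 1"
      using assms(1-3) unfolding Lambda_system_def by blast
    then have "\<forall>t\<in>set w. cmod (lam i j s t) = 1"
      using that(2) by (metis in_lists_conv_set)
    then show ?thesis by (induction w) (simp_all add: norm_mult)
  qed
  moreover have "\<alpha> j \<in> lists {1..n j}" if "j \<in> {1..<i}" for j
    using assms(2,4) that by (auto simp: Words_def PiE_iff)
  ultimately have "(\<Prod>j\<in>{1..<i}. cmod (\<Prod>t\<leftarrow>\<alpha> j. lam i j s t)) = 1"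
    by (intro prod.neutral) blast
  then show ?thesis by (simp only: phase_def prod_norm)
qed

lemma l2_apply_shift:
  assumes "Lambda_system k n lam" "i \<in> {1..k}" "s \<in> {1..n i}"
  shows "l2_apply (shift k n lam i s f) \<beta> =
    (if \<beta> \<in> Words k n \<and> (\<exists>w. \<beta> i = s # w)
     then phase lam i s \<beta> *\<^sub>C l2_apply f (\<beta>(i := tl (\<beta> i))) else 0)"
proof -
  define A where "A = {\<beta> \<in> Words k n. \<exists>w. \<beta> i = s # w}"
  define h where "h = (\<lambda>\<beta> :: words. \<beta>(i := tl (\<beta> i)))"
  let ?g = "\<lambda>\<beta>. if \<beta> \<in> Words k n \<and> (\<exists>w. \<beta> i = s # w)
     then phase lam i s \<beta> *\<^sub>C l2_apply f (\<beta>(i := tl (\<beta> i))) else 0"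
  have "inj_on h A"
  proof (rule inj_onI)
    fix \<beta> \<gamma> assume *: "\<beta> \<in> A" "\<gamma> \<in> A" "h \<beta> = h \<gamma>"
    then obtain v w where vw: "\<beta> i = s # v" "\<gamma> i = s # w" by (auto simp: A_def)
    have "(h \<beta>)(i := s # h \<beta> i) = (h \<gamma>)(i := s # h \<gamma> i)" using *(3) by simp
    then show "\<beta> = \<gamma>" using vw by (simp add: h_def) (metis fun_upd_triv)
  qed
  then have "((\<lambda>u. (norm (l2_apply f u))\<^sup>2) \<circ> h) summable_on A"
    using l2_summable[of f "h ` A"] by (simp add: summable_on_reindex)
  moreover have "((\<lambda>u. (norm (l2_apply f u))\<^sup>2) \<circ> h) summable_on A \<longleftrightarrow>
      (\<lambda>\<beta>. (norm (?g \<beta>))\<^sup>2) summable_on UNIV"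
    by (rule summable_on_cong_neutral) (auto simp: A_def h_def norm_scaleC cmod_phase[OF assms])
  ultimately show ?thesis by (simp add: shift_def Abs_l2_inverse)
qed

lemma shift_tensor:
  assumes "Lambda_system k n lam" "i \<in> {1..k}" "s \<in> {1..n i}"
  shows "shift k n lam i s (tensor f x) = tensor (shift k n lam i s f) x"
  by (rule l2_eqI) (auto simp: l2_apply_shift[OF assms] scaleC_scaleC scaleC_complex_def)

lemma shift_chi:
  assumes "Lambda_system k n lam" "i \<in> {1..k}" "s \<in> {1..n i}" "\<alpha> \<in> Words k n"
  shows "shift k n lam i s (chi \<alpha>) = phase lam i s \<alpha> *\<^sub>C chi (\<alpha>(i := s # \<alpha> i))"
proof (rule l2_eqI)
  fix \<beta>
  have W: "\<alpha>(i := s # \<alpha> i) \<in> Words k n"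
    using assms(2-4) by (auto simp: Words_def PiE_iff extensional_def)
  show "l2_apply (shift k n lam i s (chi \<alpha>)) \<beta> = l2_apply (phase lam i s \<alpha> *\<^sub>C chi (\<alpha>(i := s # \<alpha> i))) \<beta>"
  proof (cases "\<beta> = \<alpha>(i := s # \<alpha> i)")
    case True
    then show ?thesis using W by (simp add: l2_apply_shift[OF assms(1-3)])
  next
    case False
    then have "\<beta>(i := tl (\<beta> i)) \<noteq> \<alpha>" if "\<beta> i = s # w" for w
      using that by (metis fun_upd_same fun_upd_triv fun_upd_upd list.sel(3))
    then show ?thesis using False by (auto simp: l2_apply_shift[OF assms(1-3)])
  qed
qed


section \<open>Invariant subspaces\<close>

text \<open>\<open>row_cp_map H m V T = (\<Sum>s = 1..m. V s T (V s)\<^sup>*)\<close>, as operators on \<open>H\<close>.\<close>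

definition row_cp_map ::
    "'a::complex_inner set \<Rightarrow> nat \<Rightarrow> (nat \<Rightarrow> 'a \<Rightarrow> 'a) \<Rightarrow> ('a \<Rightarrow> 'a) \<Rightarrow> 'a \<Rightarrow> 'a" where
  "row_cp_map H m V T x = (\<Sum>s = 1..m. V s (T (adjoint_on H (V s) x)))"

text \<open>\<open>(id - \<Phi>\<^sub>1) \<circ> \<dots> \<circ> (id - \<Phi>\<^sub>k)\<close> applied to \<open>T\<close>; the factor with index \<open>k\<close> acts first.\<close>

definition defect_map ::
    "'a::complex_inner set \<Rightarrow> nat \<Rightarrow> (nat \<Rightarrow> nat) \<Rightarrow> (nat \<Rightarrow> nat \<Rightarrow> 'a \<Rightarrow> 'a) \<Rightarrow> ('a \<Rightarrow> 'a) \<Rightarrow> 'a \<Rightarrow> 'a" where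
  "defect_map H k n V T = foldr (\<lambda>i T x. T x - row_cp_map H (n i) (V i) T x) [1..<Suc k] T"

definition doubly_Lambda_commuting ::
    "nat \<Rightarrow> (nat \<Rightarrow> nat) \<Rightarrow> (nat \<Rightarrow> nat \<Rightarrow> nat \<Rightarrow> nat \<Rightarrow> complex) \<Rightarrow>
     'a::complex_inner set \<Rightarrow> (nat \<Rightarrow> nat \<Rightarrow> 'a \<Rightarrow> 'a) \<Rightarrow> bool" where
  "doubly_Lambda_commuting k n lam H V \<longleftrightarrow>
     (\<forall>i\<in>{1..k}. row_isometry H (n i) (V i)) \<and>
     (\<forall>i\<in>{1..k}. \<forall>j\<in>{1..k}. i \<noteq> j \<longrightarrow> (\<forall>s\<in>{1..n i}. \<forall>t\<in>{1..n j}. \<forall>x\<in>H.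
        adjoint_on H (V i s) (V j t x) = cnj (lam i j s t) *\<^sub>C V j t (adjoint_on H (V i s) x)))"

text \<open>
  Multi-analytic operators \<open>\<ell>\<^sup>2 \<otimes> L \<rightarrow> \<ell>\<^sup>2 \<otimes> K\<close>; here \<open>K\<close> is the whole type \<^typ>\<open>'a\<close>.
\<close>

definition multi_analytic ::
    "nat \<Rightarrow> (nat \<Rightarrow> nat) \<Rightarrow> (nat \<Rightarrow> nat \<Rightarrow> nat \<Rightarrow> nat \<Rightarrow> complex) \<Rightarrow> 'l::complex_inner set \<Rightarrow>
     ((words, 'l) l2 \<Rightarrow> (words, 'a::complex_inner) l2) \<Rightarrow> bool" where
  "multi_analytic k n lam L A \<longleftrightarrow>
     bounded_op (l2_tensor (Words k n) L) (l2_tensor (Words k n) UNIV) A \<and>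
     (\<forall>i\<in>{1..k}. \<forall>s\<in>{1..n i}. \<forall>f\<in>l2_tensor (Words k n) L.
        A (shift k n lam i s f) = shift k n lam i s (A f))"

definition inner_multi_analytic ::
    "nat \<Rightarrow> (nat \<Rightarrow> nat) \<Rightarrow> (nat \<Rightarrow> nat \<Rightarrow> nat \<Rightarrow> nat \<Rightarrow> complex) \<Rightarrow> 'l::complex_inner set \<Rightarrow>
     ((words, 'l) l2 \<Rightarrow> (words, 'a::complex_inner) l2) \<Rightarrow> bool" where
  "inner_multi_analytic k n lam L A \<longleftrightarrow>
     multi_analytic k n lam L A \<and> partial_isometry_on (l2_tensor (Words k n) L) A"

definition isometric_multi_analytic ::
    "nat \<Rightarrow> (nat \<Rightarrow> nat) \<Rightarrow> (nat \<Rightarrow> nat \<Rightarrow> nat \<Rightarrow> nat \<Rightarrow> complex) \<Rightarrow> 'l::complex_inner set \<Rightarrow>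
     ((words, 'l) l2 \<Rightarrow> (words, 'a::complex_inner) l2) \<Rightarrow> bool" where
  "isometric_multi_analytic k n lam L A \<longleftrightarrow>
     multi_analytic k n lam L A \<and> isometry_on (l2_tensor (Words k n) L) A"

text \<open>
  A formula cannot quantify over all Hilbert spaces, so ``for some Hilbert space \<open>L\<close>'' takes the
  ambient type of \<open>L\<close> as a parameter: \<open>L\<close> ranges over the closed subspaces of that type.
  For \<open>M \<subseteq> \<ell>\<^sup>2 \<otimes> K\<close> the type \<^typ>\<open>(words, 'a) l2\<close> of \<open>\<ell>\<^sup>2 \<otimes> K\<close> is the intended, largest necessary
  choice; that a representation with \<open>L\<close> in any other type \<^typ>\<open>'l\<close> yields one with \<open>L\<close>
  in that type is a claim to be proved, not part of the definition.
\<close>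

definition beurling_type ::
    "nat \<Rightarrow> (nat \<Rightarrow> nat) \<Rightarrow> (nat \<Rightarrow> nat \<Rightarrow> nat \<Rightarrow> nat \<Rightarrow> complex) \<Rightarrow>
     'l::chilbert_space itself \<Rightarrow> (words, 'a::chilbert_space) l2 set \<Rightarrow> bool" where
  "beurling_type k n lam _ M \<longleftrightarrow>
     (\<exists>(L :: 'l set) \<Psi>. closed_csubspace L \<and> inner_multi_analytic k n lam L \<Psi> \<and>
        M = \<Psi> ` l2_tensor (Words k n) L)"

definition isometric_beurling_type ::
    "nat \<Rightarrow> (nat \<Rightarrow> nat) \<Rightarrow> (nat \<Rightarrow> nat \<Rightarrow> nat \<Rightarrow> nat \<Rightarrow> complex) \<Rightarrow>
     'l::chilbert_space itself \<Rightarrow> (words, 'a::chilbert_space) l2 set \<Rightarrow> bool" where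
  "isometric_beurling_type k n lam _ M \<longleftrightarrow>
     (\<exists>(L :: 'l set) \<Psi>. closed_csubspace L \<and> isometric_multi_analytic k n lam L \<Psi> \<and>
        M = \<Psi> ` l2_tensor (Words k n) L)"

end

theory Submission
  imports Defs
begin

text \<open>
  All four statements are equivalent to the invariance, for \<open>i \<noteq> j\<close>, of the wandering subspace
  \<open>M \<ominus> S\<^sub>i M\<close> under the shifts \<open>S\<^sub>j\<^sub>,\<^sub>t\<close>.

  If \<open>\<Psi>\<close> is inner, the complement of its kernel is reducing, and invariance is transported from there to
  \<open>M\<close>. Conversely, invariance yields a Wold decomposition of \<open>M\<close> whose generating subspace \<open>L\<close> is the
  intersection of the \<open>M \<ominus> S\<^sub>i M\<close>; the shifted copies of \<open>L\<close> are orthogonal, and they span \<open>M\<close> since a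
  nonzero vector of a reducing subspace, stripped of its components in the ranges of the shifts,
  keeps its coefficients at words of minimal length.

  For positivity, the quadratic form \<open>q x = \<parallel>P\<^sub>M x\<parallel>\<^sup>2\<close> satisfies
  \<open>q x - \<Sum>\<^sub>s q (S\<^sub>i\<^sub>,\<^sub>s\<^sup>* x) = \<parallel>P x\<parallel>\<^sup>2\<close> with \<open>P\<close> the projection onto \<open>M \<ominus> S\<^sub>i M\<close>. Under invariance this can be
  iterated, so the defect is a projection. Conversely the shifts are pure, hence positivity of the
  full defect implies that of the defect for every pair \<open>i, j\<close>, which says
  \<open>\<Sum>\<^sub>t \<parallel>P (S\<^sub>j\<^sub>,\<^sub>t\<^sup>* x)\<parallel>\<^sup>2 \<le> \<parallel>P x\<parallel>\<^sup>2\<close>; taking \<open>x\<close> in \<open>S\<^sub>i M\<close> gives invariance.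
\<close>

section \<open>Hilbert space geometry\<close>

lemma cinner_add_right: "cinner (x :: 'a::complex_inner) (y + z) = cinner x y + cinner x z"
  by (metis cinner_add_left cinner_commute complex_cnj_add)

lemma scaleC_minus_one: "(-1) *\<^sub>C (x :: 'a::complex_inner) = - x"
  using scaleR_scaleC[of "-1" x] by simp

lemma cinner_minus_left: "cinner (- x :: 'a::complex_inner) y = - cinner x y"
  using cinner_scaleC_left[of "-1" x y] by (simp add: scaleC_minus_one)

lemma cinner_minus_right: "cinner (x :: 'a::complex_inner) (- y) = - cinner x y"
  by (metis cinner_commute cinner_minus_left complex_cnj_minus)

lemma cinner_diff_left: "cinner (x - y :: 'a::complex_inner) z = cinner x z - cinner y z"
  using cinner_add_left[of x "- y" z] by (simp add: cinner_minus_left)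

lemma cinner_diff_right: "cinner (x :: 'a::complex_inner) (y - z) = cinner x y - cinner x z"
  using cinner_add_right[of x y "- z"] by (simp add: cinner_minus_right)

lemma cinner_sum_left: "cinner (\<Sum>i\<in>I. f i :: 'a::complex_inner) y = (\<Sum>i\<in>I. cinner (f i) y)"
  by (induction I rule: infinite_finite_induct) (auto simp: cinner_add_left)

lemma cinner_sum_right: "cinner (y :: 'a::complex_inner) (\<Sum>i\<in>I. f i) = (\<Sum>i\<in>I. cinner y (f i))"
  by (induction I rule: infinite_finite_induct) (auto simp: cinner_add_right)

lemma cinner_eq_0_commute: "cinner (x :: 'a::complex_inner) y = 0 \<longleftrightarrow> cinner y x = 0"
  by (metis cinner_commute complex_cnj_zero_iff)

lemma cinner_self_eq_0 [simp]: "cinner (x :: 'a::complex_inner) x = 0 \<longleftrightarrow> x = 0"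
  by (simp add: cinner_self)

lemma norm_add_sq_cinner:
  fixes x y :: "'a::complex_inner"
  assumes "cinner x y = 0"
  shows "(norm (x + y))\<^sup>2 = (norm x)\<^sup>2 + (norm y)\<^sup>2"
  by (rule norm_add_Pythagorean) (simp add: orthogonal_def assms flip: Re_cinner)

lemma bounded_linear_scaleC: "bounded_linear (\<lambda>x :: 'a::complex_inner. a *\<^sub>C x)"
  by (rule bounded_linear_intro[where K = "cmod a"])
    (simp_all add: scaleC_add_right norm_scaleC scaleR_scaleC scaleC_scaleC mult.commute)

lemma closed_csubspace_UNIV: "closed_csubspace UNIV"
  by (simp add: closed_csubspace_def)

lemma closed_csubspace_0: "closed_csubspace M \<Longrightarrow> 0 \<in> M"
  by (simp add: closed_csubspace_def)

lemma closed_csubspace_add: "closed_csubspace M \<Longrightarrow> x \<in> M \<Longrightarrow> y \<in> M \<Longrightarrow> x + y \<in> M"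
  by (simp add: closed_csubspace_def)

lemma closed_csubspace_scaleC: "closed_csubspace M \<Longrightarrow> x \<in> M \<Longrightarrow> a *\<^sub>C x \<in> M"
  by (simp add: closed_csubspace_def)

lemma closed_csubspace_diff: "closed_csubspace M \<Longrightarrow> x \<in> M \<Longrightarrow> y \<in> M \<Longrightarrow> x - y \<in> M"
  using closed_csubspace_add[of M x "- y"] closed_csubspace_scaleC[of M y "-1"]
  by (simp add: scaleC_minus_one)

lemma closed_csubspace_sum:
  "closed_csubspace M \<Longrightarrow> (\<And>i. i \<in> I \<Longrightarrow> f i \<in> M) \<Longrightarrow> (\<Sum>i\<in>I. f i) \<in> M"
  by (induction I rule: infinite_finite_induct) (auto intro: closed_csubspace_0 closed_csubspace_add)

lemma continuous_on_cinner_left: "continuous_on UNIV (\<lambda>x :: 'a::complex_inner. cinner x y)"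
proof -
  have "bounded_linear (\<lambda>x :: 'a. cinner x y)"
    by (rule bounded_linear_intro[where K = "norm y"])
      (auto simp: cinner_add_left scaleR_scaleC cinner_scaleC_left scaleC_complex_def
        cinner_Cauchy_Schwarz)
  then show ?thesis by (rule linear_continuous_on)
qed

lemma closed_csubspace_orthogonal_in:
  assumes "closed_csubspace (M :: 'a::complex_inner set)"
  shows "closed_csubspace {x \<in> M. \<forall>z\<in>Z. cinner x z = 0}"
proof -
  have "{x \<in> M. \<forall>z\<in>Z. cinner x z = 0} = M \<inter> (\<Inter>z\<in>Z. (\<lambda>x. cinner x z) -` {0})"
    by auto
  moreover have "closed ((\<lambda>x :: 'a. cinner x z) -` {0})" for z
    by (intro closed_vimage continuous_on_cinner_left) auto
  ultimately have "closed {x \<in> M. \<forall>z\<in>Z. cinner x z = 0}"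
    using assms by (auto simp: closed_csubspace_def intro!: closed_Int closed_INT)
  then show ?thesis
    using assms by (auto simp: closed_csubspace_def cinner_add_left cinner_scaleC_left)
qed

section \<open>Existence and uniqueness of orthogonal projections\<close>

lemma inner_eq_0_if_closest:
  fixes u z :: "'a::real_inner"
  assumes "\<And>t. norm u \<le> norm (u - t *\<^sub>R z)"
  shows "inner u z = 0"
proof (cases "z = 0")
  case False
  \<comment> \<open>This \<open>t\<close> minimises the norm of \<open>u - t *\<^sub>R z\<close>;
    there the squared norm has dropped by \<open>(inner u z)\<^sup>2 / inner z z\<close>, so
    minimality of \<open>u\<close> forces \<open>inner u z = 0\<close>.\<close>
  define t where "t = inner u z / inner z z"
  have z: "inner z z > 0" using False by simp
  have "(norm u)\<^sup>2 \<le> (norm (u - t *\<^sub>R z))\<^sup>2" by (intro power_mono assms) simp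
  also have "\<dots> = (norm u)\<^sup>2 - 2 * t * inner u z + t * t * inner z z"
    unfolding power2_norm_eq_inner
    by (simp add: inner_diff_left inner_diff_right inner_commute algebra_simps)
  also have "\<dots> = (norm u)\<^sup>2 - (inner u z)\<^sup>2 / inner z z"
    using z by (simp add: t_def power2_eq_square field_simps)
  finally have "(inner u z)\<^sup>2 \<le> 0" using z by (simp add: divide_le_0_iff)
  then show ?thesis by simp
qed simp

text \<open>A minimising sequence for the distance from \<open>x\<close> to \<open>M\<close> is
  Cauchy by the parallelogram identity, because midpoints stay in \<open>M\<close>. Its limit is a
  closest point, and the vector from a closest point to \<open>x\<close> is orthogonal to
  \<open>M\<close>.\<close>

lemma ex_orth_proj:
  fixes M :: "'a::chilbert_space set"
  assumes M: "closed_csubspace M"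
  shows "\<exists>y. y \<in> M \<and> (\<forall>z\<in>M. cinner (x - y) z = 0)"
proof -
  define d where "d = infdist x M"
  have ne: "M \<noteq> {}" using closed_csubspace_0[OF M] by auto
  have d: "d \<ge> 0" "\<And>y. y \<in> M \<Longrightarrow> d \<le> norm (x - y)"
    by (auto simp: d_def infdist_nonneg infdist_le dist_norm[symmetric])
  have "\<exists>y\<in>M. (norm (x - y))\<^sup>2 < d\<^sup>2 + inverse (real (Suc m))" for m
  proof -
    have "sqrt (d\<^sup>2) < sqrt (d\<^sup>2 + inverse (real (Suc m)))" by (subst real_sqrt_less_iff) simp
    then have "d < sqrt (d\<^sup>2 + inverse (real (Suc m)))" using d by simp
    then obtain y where y: "y \<in> M" "norm (x - y) < sqrt (d\<^sup>2 + inverse (real (Suc m)))"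
      using ne cINF_less_iff[of M "dist x"] bdd_belowI2[of M 0 "dist x"]
      by (auto simp: d_def infdist_def dist_norm)
    have "(norm (x - y))\<^sup>2 < (sqrt (d\<^sup>2 + inverse (real (Suc m))))\<^sup>2"
      by (rule power_strict_mono) (use y in auto)
    then show ?thesis using y(1) d by (auto simp: add_nonneg_nonneg)
  qed
  then obtain y where y: "\<And>m. y m \<in> M"
    "\<And>m. (norm (x - y m))\<^sup>2 < d\<^sup>2 + inverse (real (Suc m))"
    by metis
  have half: "(norm (y m - y p))\<^sup>2 \<le> 2 * inverse (real (Suc m)) + 2 * inverse (real (Suc p))" for m p
  proof -
    define w where "w = (1/2) *\<^sub>R (y m + y p)"
    have "w \<in> M" unfolding w_def scaleR_scaleC
      by (intro closed_csubspace_scaleC[OF M] closed_csubspace_add[OF M] y)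
    then have "d\<^sup>2 \<le> (norm (x - w))\<^sup>2" using d by (intro power_mono) auto
    moreover have "(norm (y m - y p))\<^sup>2 =
        2 * (norm (x - y m))\<^sup>2 + 2 * (norm (x - y p))\<^sup>2 - 4 * (norm (x - w))\<^sup>2"
      unfolding power2_norm_eq_inner w_def
      by (simp add: inner_diff_left inner_diff_right inner_add_left inner_add_right inner_commute
          algebra_simps)
    ultimately show ?thesis using y(2)[of m] y(2)[of p] by linarith
  qed
  have "Cauchy y"
  proof (rule metric_CauchyI)
    fix e :: real assume e: "e > 0"
    then obtain N where N: "N > 0" "inverse (real N) < e\<^sup>2 / 4"
      using ex_inverse_of_nat_less[of "e\<^sup>2 / 4"] by auto
    have "dist (y m) (y p) < e" if "m \<ge> N" "p \<ge> N" for m p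
    proof -
      have inv: "inverse (real (Suc q)) < e\<^sup>2 / 4" if "q \<ge> N" for q
        using N that by (smt (verit) le_imp_inverse_le of_nat_0_less_iff of_nat_Suc of_nat_le_iff)
      have "(norm (y m - y p))\<^sup>2 < e\<^sup>2" 
        using half[of m p] inv[OF that(1)] inv[OF that(2)] by linarith
      then show ?thesis using e by (simp add: dist_norm power2_less_imp_less)
    qed
    then show "\<exists>N. \<forall>m\<ge>N. \<forall>p\<ge>N. dist (y m) (y p) < e" by blast
  qed
  then obtain l where l: "y \<longlonglongrightarrow> l" using Cauchy_convergent convergent_def by blast
  have lM: "l \<in> M"
    using M l y(1) closed_sequentially[of M y l] by (simp add: closed_csubspace_def)
  have "(norm (x - l))\<^sup>2 \<le> d\<^sup>2"
  proof (rule LIMSEQ_le)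
    show "(\<lambda>m. (norm (x - y m))\<^sup>2) \<longlonglongrightarrow> (norm (x - l))\<^sup>2" by (intro tendsto_intros l)
    show "(\<lambda>m. d\<^sup>2 + inverse (real (Suc m))) \<longlonglongrightarrow> d\<^sup>2"
      using tendsto_add[OF tendsto_const LIMSEQ_inverse_real_of_nat, of "d\<^sup>2"] by simp
  qed (use y(2) less_imp_le in blast)
  then have nl: "norm (x - l) \<le> d" using d by (simp add: power2_le_iff_abs_le)
  have re: "Re (cinner (x - l) z) = 0" if "z \<in> M" for z
    unfolding Re_cinner
  proof (rule inner_eq_0_if_closest)
    fix t
    have "l + t *\<^sub>R z \<in> M" unfolding scaleR_scaleC
      by (intro closed_csubspace_scaleC[OF M] closed_csubspace_add[OF M] that lM)
    then show "norm (x - l) \<le> norm (x - l - t *\<^sub>R z)"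
      using d(2)[of "l + t *\<^sub>R z"] nl by (simp add: diff_diff_eq)
  qed
  \<comment> \<open>Minimality over real multiples controls only the real part; applying it to
    \<open>\<i> *\<^sub>C z\<close> gives the imaginary part.\<close>
  have "cinner (x - l) z = 0" if "z \<in> M" for z
    using re[OF that] re[OF closed_csubspace_scaleC[OF M that, of \<i>]]
    by (simp add: cinner_scaleC_right complex_eq_iff)
  then show ?thesis using lM by blast
qed

text \<open>Two candidates differ by an element of \<open>M\<close> that is orthogonal to itself.
  Projections are computed below by guessing the value and applying this rule.\<close>

lemma orth_proj_unique:
  fixes M :: "'a::complex_inner set"
  assumes "closed_csubspace M" "y \<in> M" "\<forall>z\<in>M. cinner (x - y) z = 0"
  shows "orth_proj M x = y"
  unfolding orth_proj_def
proof (rule the_equality)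
  fix y' assume y': "y' \<in> M \<and> (\<forall>z\<in>M. cinner (x - y') z = 0)"
  have "y - y' \<in> M" using assms y' by (intro closed_csubspace_diff) auto
  then have "cinner ((x - y') - (x - y)) (y - y') = 0"
    using assms(3) y' by (simp only: cinner_diff_left) simp
  then show "y' = y" by simp
qed (use assms in auto)

lemma orth_proj_in: "closed_csubspace M \<Longrightarrow> orth_proj M (x :: 'a::chilbert_space) \<in> M"
  using ex_orth_proj[of M x] orth_proj_unique[of M _ x] by metis

lemma cinner_diff_orth_proj:
  "closed_csubspace M \<Longrightarrow> z \<in> M \<Longrightarrow> cinner (x - orth_proj M (x :: 'a::chilbert_space)) z = 0"
  using ex_orth_proj[of M x] orth_proj_unique[of M _ x] by metis

lemma cinner_orth_proj_left:
  "closed_csubspace M \<Longrightarrow> z \<in> M \<Longrightarrow> cinner (orth_proj M (x :: 'a::chilbert_space)) z = cinner x z"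
  using cinner_diff_orth_proj[of M z x] by (simp add: cinner_diff_left)

lemma cinner_orth_proj_right:
  "closed_csubspace M \<Longrightarrow> z \<in> M \<Longrightarrow> cinner z (orth_proj M (x :: 'a::chilbert_space)) = cinner z x"
  by (metis cinner_commute cinner_orth_proj_left)

lemma orth_proj_scaleC:
  fixes x :: "'a::chilbert_space"
  assumes M: "closed_csubspace M"
  shows "orth_proj M (a *\<^sub>C x) = a *\<^sub>C orth_proj M x"
  by (rule orth_proj_unique[OF M])
    (auto simp: closed_csubspace_scaleC orth_proj_in M cinner_scaleC_left cinner_diff_left
      cinner_orth_proj_left)

lemma norm_orth_proj_le:
  fixes x :: "'a::chilbert_space"
  assumes M: "closed_csubspace M"
  shows "norm (orth_proj M x) \<le> norm x"
proof -
  have "(norm (orth_proj M x))\<^sup>2 \<le> (norm (orth_proj M x))\<^sup>2 + (norm (x - orth_proj M x))\<^sup>2" by simp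
  also have "\<dots> = (norm (orth_proj M x + (x - orth_proj M x)))\<^sup>2"
    by (rule norm_add_sq_cinner[symmetric], subst cinner_eq_0_commute)
      (simp add: cinner_diff_orth_proj orth_proj_in M)
  finally show ?thesis by (simp add: power2_le_iff_abs_le)
qed

text \<open>Polarisation: the norm of \<open>x + y\<close> determines the real part of the inner
  product, and replacing \<open>y\<close> by \<open>\<i> *\<^sub>C y\<close> the imaginary
  part.\<close>

lemma isometry_preserves_cinner:
  fixes U :: "'a::complex_inner \<Rightarrow> 'b::complex_inner"
  assumes N: "closed_csubspace N"
    and add: "\<And>x y. x \<in> N \<Longrightarrow> y \<in> N \<Longrightarrow> U (x + y) = U x + U y"
    and scale: "\<And>a x. x \<in> N \<Longrightarrow> U (a *\<^sub>C x) = a *\<^sub>C U x"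
    and iso: "\<And>x. x \<in> N \<Longrightarrow> norm (U x) = norm x"
    and xy: "x \<in> N" "y \<in> N"
  shows "cinner (U x) (U y) = cinner x y"
proof -
  have re: "Re (cinner (U x) (U y)) = Re (cinner x y)" if "x \<in> N" "y \<in> N" for x y
  proof -
    have "norm (U x + U y) = norm (x + y)"
      using iso[OF closed_csubspace_add[OF N that]] add[OF that] by simp
    then show ?thesis
      using iso[OF that(1)] iso[OF that(2)]
      by (simp add: Re_cinner norm_eq_sqrt_inner inner_add_left inner_add_right inner_commute)
  qed
  have "Im (cinner (U x) (U y)) = Im (cinner x y)"
    using re[OF xy(1) closed_csubspace_scaleC[OF N xy(2), of \<i>]]
    by (simp add: scale xy cinner_scaleC_right)
  then show ?thesis using re[OF xy] by (simp add: complex_eq_iff)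
qed

section \<open>Orthogonal series\<close>

text \<open>By Pythagoras the squared distance between nested partial sums is a difference of
  partial sums of the squared norms, so the net of partial sums is Cauchy.\<close>

lemma orthogonal_summable_on:
  fixes x :: "'i \<Rightarrow> 'a::chilbert_space"
  assumes orth: "\<And>i j. i \<in> A \<Longrightarrow> j \<in> A \<Longrightarrow> i \<noteq> j \<Longrightarrow> cinner (x i) (x j) = 0"
    and sum: "(\<lambda>i. (norm (x i))\<^sup>2) summable_on A"
  shows "x summable_on A" "(norm (infsum x A))\<^sup>2 = (\<Sum>\<^sub>\<infinity>i\<in>A. (norm (x i))\<^sup>2)"
proof -
  have pyth: "(norm (sum x F))\<^sup>2 = (\<Sum>i\<in>F. (norm (x i))\<^sup>2)" if "finite F" "F \<subseteq> A" for F
    using that by (intro norm_sum_Pythagorean)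
      (auto simp: pairwise_def orthogonal_def orth subset_iff simp flip: Re_cinner)
  have "\<exists>P. eventually P (finite_subsets_at_top A) \<and>
          (\<forall>F F'. P F \<and> P F' \<longrightarrow> dist (sum x F) (sum x F') < e)" if e: "e > 0" for e
  proof -
    define q where "q = (\<lambda>F. \<Sum>i\<in>F. (norm (x i))\<^sup>2)"
    define s where "s = (\<Sum>\<^sub>\<infinity>i\<in>A. (norm (x i))\<^sup>2)"
    have le: "q F \<le> s" if "finite F" "F \<subseteq> A" for F
      unfolding q_def s_def using that sum by (intro finite_sum_le_infsum) auto
    \<comment> \<open>Comparing two partial sums through \<open>F0\<close> doubles each error, and
      \<open>2/5 + 2/5\<close> of \<open>e\<^sup>2\<close> stays strictly below
      \<open>e\<^sup>2\<close>.\<close>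
    obtain F0 where F0: "finite F0" "F0 \<subseteq> A" "dist (q F0) s \<le> e\<^sup>2 / 5"
      using infsum_finite_approximation[OF sum, of "e\<^sup>2 / 5"] e unfolding q_def s_def by auto
    have *: "(norm (sum x F - sum x F0))\<^sup>2 \<le> e\<^sup>2 / 5" if "finite F" "F0 \<subseteq> F" "F \<subseteq> A" for F
    proof -
      have "sum x F - sum x F0 = sum x (F - F0)" using that by (simp add: sum_diff)
      then have "(norm (sum x F - sum x F0))\<^sup>2 = (\<Sum>i\<in>F - F0. (norm (x i))\<^sup>2)"
        using that pyth[of "F - F0"] by auto
      also have "\<dots> = q F - q F0"
        unfolding q_def by (rule sum_diff) (use that in auto)
      finally have "(norm (sum x F - sum x F0))\<^sup>2 = q F - q F0" .
      moreover have "s - q F0 \<le> e\<^sup>2 / 5" using F0(3) unfolding dist_real_def by linarith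
      ultimately show ?thesis using le[of F] that by linarith
    qed
    show ?thesis
    proof (intro exI[of _ "\<lambda>F. finite F \<and> F0 \<subseteq> F \<and> F \<subseteq> A"] conjI allI impI)
      show "eventually (\<lambda>F. finite F \<and> F0 \<subseteq> F \<and> F \<subseteq> A) (finite_subsets_at_top A)"
        unfolding eventually_finite_subsets_at_top using F0 by blast
      fix F F' assume F: "(finite F \<and> F0 \<subseteq> F \<and> F \<subseteq> A) \<and> finite F' \<and> F0 \<subseteq> F' \<and> F' \<subseteq> A"
      have "(norm ((sum x F - sum x F0) + (sum x F0 - sum x F')))\<^sup>2 \<le>
          2 * (norm (sum x F - sum x F0))\<^sup>2 + 2 * (norm (sum x F0 - sum x F'))\<^sup>2"
        by (rule norm_add_sq_le)
      also have "\<dots> \<le> 2 * (e\<^sup>2 / 5) + 2 * (e\<^sup>2 / 5)"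
        using F *[of F] *[of F'] by (simp add: norm_minus_commute)
      also have "\<dots> < e\<^sup>2" using e by simp
      finally have "(norm (sum x F - sum x F'))\<^sup>2 < e\<^sup>2" by simp
      then show "dist (sum x F) (sum x F') < e"
        using e by (simp add: dist_norm power2_less_imp_less)
    qed
  qed
  then have "cauchy_filter (filtermap (sum x) (finite_subsets_at_top A))"
    by (simp add: cauchy_filter_metric_filtermap)
  moreover have "complete (UNIV::'a set)"
    by (rule complete_UNIV_cuspace)
  ultimately obtain l where l: "(sum x \<longlongrightarrow> l) (finite_subsets_at_top A)"
    using complete_uniform[where S = UNIV] by (force simp add: filterlim_def)
  then show s: "x summable_on A"
    using summable_on_def has_sum_def by blast
  have lim: "((\<lambda>F. (norm (sum x F))\<^sup>2) \<longlongrightarrow> (norm (infsum x A))\<^sup>2) (finite_subsets_at_top A)"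
    using has_sum_infsum[OF s] unfolding has_sum_def by (intro tendsto_intros)
  have "((\<lambda>F. \<Sum>i\<in>F. (norm (x i))\<^sup>2) \<longlongrightarrow> (norm (infsum x A))\<^sup>2) (finite_subsets_at_top A)"
    by (rule Lim_transform_eventually[OF lim])
      (auto intro: eventually_finite_subsets_at_top_weakI simp: pyth)
  then show "(norm (infsum x A))\<^sup>2 = (\<Sum>\<^sub>\<infinity>i\<in>A. (norm (x i))\<^sup>2)"
    by (metis has_sum_def infsumI)
qed

lemma infsum_in_closed_csubspace:
  fixes x :: "'i \<Rightarrow> 'a::complex_inner"
  assumes M: "closed_csubspace M" and x: "\<And>i. i \<in> A \<Longrightarrow> x i \<in> M" and s: "x summable_on A"
  shows "infsum x A \<in> M"
proof (rule Lim_in_closed_set)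
  show "closed M" using M by (simp add: closed_csubspace_def)
  show "(sum x \<longlongrightarrow> infsum x A) (finite_subsets_at_top A)"
    using has_sum_infsum[OF s] by (simp add: has_sum_def)
  show "\<forall>\<^sub>F F in finite_subsets_at_top A. sum x F \<in> M"
    using x by (intro eventually_finite_subsets_at_top_weakI closed_csubspace_sum[OF M]) auto
qed simp

section \<open>The shifts and their adjoints\<close>

text \<open>The phase sees only components of index below \<open>i\<close>. Hence, of two shifts
  with different indices, exactly one notices the letter added by the other.\<close>

lemma phase_Cons:
  "phase lam i s (\<alpha>(j := t # w)) =
    (if j \<in> {1..<i} then lam i j s t * phase lam i s (\<alpha>(j := w)) else phase lam i s \<alpha>)"
proof (cases "j \<in> {1..<i}")
  case True
  have "phase lam i s (\<alpha>(j := v)) =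
      (\<Prod>t\<leftarrow>v. lam i j s t) * (\<Prod>l\<in>{1..<i} - {j}. \<Prod>t\<leftarrow>\<alpha> l. lam i l s t)" for v
    unfolding phase_def using True by (subst prod.remove[of _ j]) auto
  then show ?thesis using True by (simp add: mult.assoc)
next
  case False
  then show ?thesis unfolding phase_def by (auto intro!: prod.cong)
qed

locale shift_model =
  fixes k :: nat and n :: "nat \<Rightarrow> nat" and lam :: "nat \<Rightarrow> nat \<Rightarrow> nat \<Rightarrow> nat \<Rightarrow> complex"
  assumes Lambda: "Lambda_system k n lam"
begin

abbreviation "W \<equiv> Words k n"
abbreviation "S \<equiv> shift k n lam"
abbreviation "letter i s \<equiv> i \<in> {1..k} \<and> s \<in> {1..n i}"

text \<open>The adjoint of \<open>S i s\<close>, given by its coefficients and identified in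
  \<open>cinner_shift\<close>.\<close>

definition coshift :: "nat \<Rightarrow> nat \<Rightarrow> (words, 'a::complex_inner) l2 \<Rightarrow> (words, 'a) l2" where
  "coshift i s f = Abs_l2 (\<lambda>\<alpha>.
     if \<alpha> \<in> W then cnj (phase lam i s \<alpha>) *\<^sub>C l2_apply f (\<alpha>(i := s # \<alpha> i)) else 0)"

lemma Words_Cons: "letter i s \<Longrightarrow> \<alpha> \<in> W \<Longrightarrow> \<alpha>(i := s # \<alpha> i) \<in> W"
  by (auto simp: Words_def PiE_iff extensional_def)

lemma Words_tl:
  assumes "\<beta> \<in> W" "i \<in> {1..k}" "\<beta> i = s # w"
  shows "\<beta>(i := w) \<in> W" "s \<in> {1..n i}"
proof -
  have "\<beta> i \<in> lists {1..n i}" using assms(1,2) by (auto simp: Words_def PiE_iff)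
  then have *: "s \<in> {1..n i}" "w \<in> lists {1..n i}" using assms(3) by auto
  show "s \<in> {1..n i}" by fact
  show "\<beta>(i := w) \<in> W" using assms(1,2) *(2) by (auto simp: Words_def PiE_iff extensional_def)
qed

lemma inj_Cons_upd: "inj_on (\<lambda>\<alpha> :: words. \<alpha>(i := s # \<alpha> i)) A"
proof (rule inj_onI)
  fix \<alpha> \<beta> :: words assume "\<alpha>(i := s # \<alpha> i) = \<beta>(i := s # \<beta> i)"
  then show "\<alpha> = \<beta>" by (metis fun_upd_eqD fun_upd_triv fun_upd_upd list.inject)
qed

lemma lam_mult:
  assumes "letter i s" "letter j t" "i \<noteq> j"
  shows "lam j i t s = cnj (lam i j s t)" "lam i j s t * cnj (lam i j s t) = 1"
    "cmod (lam i j s t) = 1"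
proof -
  have *: "cmod (lam i j s t) = 1" "lam j i t s = cnj (lam i j s t)"
    using Lambda assms unfolding Lambda_system_def by blast+
  then show "cmod (lam i j s t) = 1" "lam j i t s = cnj (lam i j s t)" by auto
  show "lam i j s t * cnj (lam i j s t) = 1" using * by (simp flip: complex_norm_square)
qed

lemma phase_mult_cnj:
  "letter i s \<Longrightarrow> \<alpha> \<in> W \<Longrightarrow> phase lam i s \<alpha> * cnj (phase lam i s \<alpha>) = 1"
  using cmod_phase[OF Lambda, of i s \<alpha>] by (simp flip: complex_norm_square)

lemma l2_apply_shift_eq:
  assumes "letter i s"
  shows "l2_apply (S i s f) \<beta> =
    (if \<beta> \<in> W \<and> (\<exists>w. \<beta> i = s # w)
     then phase lam i s \<beta> *\<^sub>C l2_apply f (\<beta>(i := tl (\<beta> i))) else 0)"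
  using l2_apply_shift[OF Lambda] assms by blast

lemma l2_apply_shift_Cons:
  assumes "letter i s" "\<alpha> \<in> W"
  shows "l2_apply (S i s f) (\<alpha>(i := s # \<alpha> i)) = phase lam i s \<alpha> *\<^sub>C l2_apply f \<alpha>"
  using Words_Cons[OF assms] by (simp add: l2_apply_shift_eq[OF assms(1)])

lemma l2_apply_coshift:
  assumes "letter i s"
  shows "l2_apply (coshift i s f) \<alpha> =
    (if \<alpha> \<in> W then cnj (phase lam i s \<alpha>) *\<^sub>C l2_apply f (\<alpha>(i := s # \<alpha> i)) else 0)"
proof -
  let ?h = "\<lambda>\<alpha> :: words. \<alpha>(i := s # \<alpha> i)"
  have "((\<lambda>u. (norm (l2_apply f u))\<^sup>2) \<circ> ?h) summable_on W"
    using l2_summable[of f "?h ` W"] summable_on_reindex[OF inj_Cons_upd] by blast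
  moreover have "((\<lambda>u. (norm (l2_apply f u))\<^sup>2) \<circ> ?h) summable_on W \<longleftrightarrow>
      (\<lambda>\<alpha>. (norm (if \<alpha> \<in> W then cnj (phase lam i s \<alpha>) *\<^sub>C l2_apply f (?h \<alpha>) else 0))\<^sup>2) summable_on UNIV"
    using assms by (intro summable_on_cong_neutral) (auto simp: norm_scaleC cmod_phase[OF Lambda])
  ultimately show ?thesis by (simp add: coshift_def Abs_l2_inverse)
qed

lemma shift_in_l2_tensor:
  assumes "letter i s" "closed_csubspace L" "f \<in> l2_tensor W L"
  shows "S i s f \<in> l2_tensor W L"
  using assms
  by (auto simp: l2_tensor_def l2_apply_shift_eq closed_csubspace_scaleC closed_csubspace_0)

lemma coshift_in_l2_tensor:
  assumes "letter i s" "closed_csubspace L" "\<And>u. l2_apply f u \<in> L"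
  shows "coshift i s f \<in> l2_tensor W L"
  using assms
  by (auto simp: l2_tensor_def l2_apply_coshift closed_csubspace_scaleC closed_csubspace_0)

lemma shift_add: "letter i s \<Longrightarrow> S i s (f + g) = S i s f + S i s g"
  by (rule l2_eqI) (auto simp: l2_apply_shift_eq scaleC_add_right)

lemma shift_scaleC: "letter i s \<Longrightarrow> S i s (a *\<^sub>C f) = a *\<^sub>C S i s f"
  by (rule l2_eqI) (auto simp: l2_apply_shift_eq scaleC_scaleC mult.commute)

lemma coshift_scaleC: "letter i s \<Longrightarrow> coshift i s (a *\<^sub>C f) = a *\<^sub>C coshift i s f"
  by (rule l2_eqI) (simp add: l2_apply_coshift scaleC_scaleC mult.commute)

lemma shift_0: "letter i s \<Longrightarrow> S i s 0 = 0"
  using shift_scaleC[of i s 0 0] by simp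

lemma shift_sum: "letter i s \<Longrightarrow> S i s (\<Sum>r\<in>R. f r) = (\<Sum>r\<in>R. S i s (f r))"
  by (induction R rule: infinite_finite_induct) (simp_all add: shift_add shift_0)

text \<open>The left side only involves words whose component \<open>i\<close> begins with
  \<open>s\<close>; reindexing them by the word with that letter removed gives the right
  side.\<close>

lemma cinner_shift:
  assumes ls: "letter i s"
  shows "cinner (S i s f) g = cinner f (coshift i s g)"
proof -
  let ?h = "\<lambda>\<alpha> :: words. \<alpha>(i := s # \<alpha> i)"
  have "cinner (S i s f) g = (\<Sum>\<^sub>\<infinity>\<beta>\<in>?h ` W. cinner (l2_apply (S i s f) \<beta>) (l2_apply g \<beta>))"
    unfolding cinner_l2_def
  proof (rule infsum_cong_neutral)
    fix \<beta> assume "\<beta> \<in> UNIV - ?h ` W"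
    moreover have "\<beta> \<in> ?h ` W" if "\<beta> \<in> W" "\<beta> i = s # w" for w
      using ls Words_tl[OF that(1) _ that(2)] that(2)
      by (intro image_eqI[of _ _ "\<beta>(i := w)"]) (auto simp: fun_upd_idem)
    ultimately show "cinner (l2_apply (S i s f) \<beta>) (l2_apply g \<beta>) = 0"
      by (auto simp: l2_apply_shift_eq[OF ls])
  qed auto
  also have "\<dots> = (\<Sum>\<^sub>\<infinity>\<alpha>\<in>W. cinner (l2_apply (S i s f) (?h \<alpha>)) (l2_apply g (?h \<alpha>)))"
    by (subst infsum_reindex[OF inj_Cons_upd]) (simp add: o_def)
  also have "\<dots> = cinner f (coshift i s g)"
    unfolding cinner_l2_def
    by (rule infsum_cong_neutral)
      (auto simp: l2_apply_shift_Cons[OF ls] l2_apply_coshift[OF ls] cinner_scaleC_left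
        cinner_scaleC_right)
  finally show ?thesis .
qed

lemma cinner_shift_right:
  assumes "letter i s"
  shows "cinner f (S i s g) = cinner (coshift i s f) g"
  using cinner_shift[OF assms, of g f] by (metis cinner_commute)

lemma coshift_shift_apply:
  assumes "letter i s" "letter i t" "\<alpha> \<in> W"
  shows "l2_apply (coshift i s (S i t f)) \<alpha> = (if s = t then l2_apply f \<alpha> else 0)"
  using assms Words_Cons[OF assms(1,3)] phase_mult_cnj[OF assms(1,3)]
  by (cases "s = t") (simp_all add: l2_apply_coshift l2_apply_shift_eq scaleC_scaleC mult.commute)

text \<open>The shifts with index \<open>i\<close> are isometries with orthogonal ranges. The
  support of \<open>f\<close> matters, since \<open>coshift\<close> discards coefficients outside
  \<open>W\<close>.\<close>

lemma coshift_shift_same: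
  assumes "letter i s" "letter i t" "f \<in> l2_tensor W UNIV"
  shows "coshift i s (S i t f) = (if s = t then f else 0)"
proof (rule l2_eqI)
  show "l2_apply (coshift i s (S i t f)) u = l2_apply (if s = t then f else 0) u" for u
    using coshift_shift_apply[OF assms(1,2), of u f] assms
    by (cases "u \<in> W") (auto simp: l2_tensor_def l2_apply_coshift)
qed

lemma cinner_shift_shift:
  assumes "letter i s" "letter i t" "f \<in> l2_tensor W UNIV"
  shows "cinner (S i s f) (S i t g) = (if s = t then cinner f g else 0)"
  using coshift_shift_same[of i t s f] assms by (simp add: cinner_shift_right)

lemma norm_shift:
  assumes "letter i s" "f \<in> l2_tensor W UNIV"
  shows "norm (S i s f) = norm f"
  using cinner_shift_shift[OF assms(1,1,2), of f] by (simp add: cinner_self power2_eq_iff_nonneg flip: of_real_power)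

text \<open>The bound is proved on the whole type: there \<open>coshift i s (S i s f)\<close> is
  \<open>f\<close> cut off to \<open>W\<close>, whose inner product with \<open>f\<close> is at most
  the squared norm. It lets shifts pass through infinite sums.\<close>

lemma bounded_linear_shift:
  assumes ls: "letter i s"
  shows "bounded_linear (S i s)"
proof (rule bounded_linear_intro[where K = 1])
  fix f :: "(words, 'a) l2"
  have "(norm (S i s f))\<^sup>2 = inner f (coshift i s (S i s f))"
    using cinner_shift[OF ls, of f "S i s f"] by (simp add: cinner_self flip: Re_cinner)
      (metis Re_complex_of_real of_real_power)
  also have "\<dots> \<le> (norm f)\<^sup>2"
    unfolding norm_l2_sq inner_l2_def
  proof (rule infsum_mono[OF l2_inner_summable l2_summable])
    fix u show "inner (l2_apply f u) (l2_apply (coshift i s (S i s f)) u) \<le> (norm (l2_apply f u))\<^sup>2"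
      using coshift_shift_apply[OF ls ls, of u f]
      by (cases "u \<in> W") (auto simp: power2_norm_eq_inner l2_apply_coshift[OF ls])
  qed
  finally show "norm (S i s f) \<le> norm f * 1" by (simp add: power2_le_iff_abs_le)
qed (simp_all add: shift_add[OF ls] shift_scaleC[OF ls] scaleR_scaleC)

lemma norm_coshift_le:
  assumes ls: "letter i s"
  shows "norm (coshift i s f) \<le> norm f"
proof -
  have "coshift i s f \<in> l2_tensor W UNIV"
    by (rule coshift_in_l2_tensor[OF ls closed_csubspace_UNIV]) simp
  then have "(norm (coshift i s f))\<^sup>2 \<le> norm f * norm (coshift i s f)"
    using cinner_Cauchy_Schwarz[of f "S i s (coshift i s f)"]
    by (simp add: cinner_shift_right[OF ls] cinner_self norm_shift[OF ls] norm_power)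
  then show ?thesis
    by (cases "norm (coshift i s f) = 0") (auto simp: power2_eq_square)
qed

text \<open>If \<open>j < i\<close>, the factor comes from the conjugated phase of
  \<open>coshift i s\<close>; if \<open>i < j\<close>, it is \<open>lam j i t s\<close> from the
  phase of \<open>S j t\<close>. Both are \<open>cnj (lam i j s t)\<close>.\<close>

lemma coshift_shift:
  assumes "letter i s" "letter j t" "i \<noteq> j"
  shows "coshift i s (S j t f) = cnj (lam i j s t) *\<^sub>C S j t (coshift i s f)"
proof (rule l2_eqI)
  fix \<alpha>
  show "l2_apply (coshift i s (S j t f)) \<alpha> = l2_apply (cnj (lam i j s t) *\<^sub>C S j t (coshift i s f)) \<alpha>"
  proof (cases "\<alpha> \<in> W \<and> (\<exists>w. \<alpha> j = t # w)")
    case True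
    then obtain w where w: "\<alpha> \<in> W" "\<alpha> j = t # w" by blast
    define \<beta> where "\<beta> = \<alpha>(j := w)"
    have \<beta>: "\<beta> \<in> W" using Words_tl[of \<alpha> j t w] w assms by (simp add: \<beta>_def)
    have \<alpha>: "\<alpha> = \<beta>(j := t # w)" "\<beta> j = w" using w(2) by (auto simp: \<beta>_def fun_upd_idem)
    have "cnj (phase lam i s (\<beta>(j := t # w))) * phase lam j t (\<beta>(i := s # \<beta> i)) =
        cnj (lam i j s t) * (phase lam j t \<beta> * cnj (phase lam i s \<beta>))"
      using assms lam_mult(1)[OF assms] fun_upd_idem[of \<beta> j w] \<alpha>(2) by (auto simp: phase_Cons)
    moreover have "\<beta>(j := w) = \<beta>" "\<beta>(i := s # \<beta> i, j := w) = \<beta>(i := s # \<beta> i)"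
      using \<alpha>(2) assms(3) by (auto simp: fun_eq_iff)
    ultimately show ?thesis
      using assms w(1) \<alpha>(2) \<beta> Words_Cons[OF assms(1) w(1)]
      unfolding \<alpha>(1)
      by (simp add: l2_apply_coshift l2_apply_shift_eq scaleC_scaleC fun_upd_twist[of j i])
  next
    case False
    then show ?thesis using assms by (auto simp: l2_apply_coshift l2_apply_shift_eq)
  qed
qed

text \<open>Both sides read the coefficient of \<open>f\<close> at the word with both leading
  letters removed. The phases differ by the one factor that the shift of larger index picks up from
  the other letter.\<close>

lemma shift_shift:
  assumes "letter i s" "letter j t" "i \<noteq> j"
  shows "S i s (S j t f) = lam i j s t *\<^sub>C S j t (S i s f)"
proof (rule l2_eqI)
  fix \<alpha>
  show "l2_apply (S i s (S j t f)) \<alpha> = l2_apply (lam i j s t *\<^sub>C S j t (S i s f)) \<alpha>"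
  proof (cases "\<alpha> \<in> W \<and> (\<exists>w. \<alpha> j = t # w) \<and> (\<exists>v. \<alpha> i = s # v)")
    case True
    then obtain v w where w: "\<alpha> \<in> W" "\<alpha> j = t # w" "\<alpha> i = s # v" by blast
    define \<beta> where "\<beta> = \<alpha>(j := w, i := v)"
    have W1: "\<alpha>(j := w) \<in> W" "\<alpha>(i := v) \<in> W"
      using Words_tl[of \<alpha> j t w] Words_tl[of \<alpha> i s v] w assms by auto
    have upd: "\<beta>(j := t # w) = \<alpha>(i := v)" "\<beta>(i := s # v) = \<alpha>(j := w)" "\<beta>(j := w) = \<beta>" "\<beta>(i := v) = \<beta>"
      using w assms(3) by (auto simp: \<beta>_def fun_eq_iff)
    have 1: "phase lam i s \<alpha> = (if j \<in> {1..<i} then lam i j s t * phase lam i s \<beta> else phase lam i s \<beta>)"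
      using phase_Cons[of lam i s \<beta> j t w] by (simp add: upd)
    have 2: "phase lam j t \<alpha> = (if i \<in> {1..<j} then lam j i t s * phase lam j t \<beta> else phase lam j t \<beta>)"
      using phase_Cons[of lam j t \<beta> i s v] by (simp add: upd)
    have 3: "phase lam j t (\<alpha>(i := v)) = phase lam j t \<beta>" "phase lam i s (\<alpha>(j := w)) = phase lam i s \<beta>"
      unfolding \<beta>_def by (subst fun_upd_twist[OF assms(3)[symmetric]], simp_all)
    have "phase lam i s \<alpha> * phase lam j t (\<alpha>(i := v)) =
        lam i j s t * (phase lam j t \<alpha> * phase lam i s (\<alpha>(j := w)))"
      unfolding 3 1 2 using assms lam_mult[OF assms] by auto
    then show ?thesis
      using assms w W1
      by (simp add: l2_apply_shift_eq scaleC_scaleC fun_upd_twist[of i j])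
  next
    case False
    then show ?thesis using assms by (auto simp: l2_apply_shift_eq)
  qed
qed

text \<open>The adjoint of \<open>shift_shift\<close>.\<close>

lemma coshift_coshift:
  assumes "letter i s" "letter j t" "i \<noteq> j"
  shows "coshift i s (coshift j t f) = lam i j s t *\<^sub>C coshift j t (coshift i s f)"
    (is "?a = ?b")
proof -
  have "cinner z ?a = cinner z ?b" for z
    using assms shift_shift[of j t i s z] lam_mult(1)[OF assms]
    by (simp add: cinner_shift[symmetric] cinner_scaleC_left cinner_scaleC_right)
  then have "cinner (?a - ?b) (?a - ?b) = 0" by (simp only: cinner_diff_right) simp
  then show ?thesis by simp
qed

end

section \<open>Wandering subspaces\<close>

lemma adjoint_on_eqI:
  fixes A :: "'a::complex_inner \<Rightarrow> 'b::complex_inner"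
  assumes H: "closed_csubspace H" and x: "x \<in> H" "\<And>z. z \<in> H \<Longrightarrow> cinner (A z) y = cinner z x"
  shows "adjoint_on H A y = x"
  unfolding adjoint_on_def
proof (rule the_equality)
  fix x' assume x': "x' \<in> H \<and> (\<forall>z\<in>H. cinner (A z) y = cinner z x')"
  have d: "x' - x \<in> H" using H x x' by (intro closed_csubspace_diff) auto
  then have "cinner (x' - x) (x' - x) = 0" using x x' by (simp add: cinner_diff_right[of "x' - x"])
  then show "x' = x" by simp
qed (use x in auto)

context shift_model
begin

text \<open>The intersection over \<open>i\<close> in \<open>A\<close> of the subspaces M minus S_i
  M in the orthogonal sense. Index sets make it possible to add one index at a time, from
  \<open>M\<close> itself to the generating subspace of the Wold decomposition.\<close>

definition wandering :: "nat set \<Rightarrow> (words, 'a::complex_inner) l2 set \<Rightarrow> (words, 'a) l2 set" where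
  "wandering A M = {y \<in> M. \<forall>i\<in>A. \<forall>s\<in>{1..n i}. \<forall>z\<in>M. cinner y (S i s z) = 0}"

lemma wanderingD:
  "y \<in> wandering A M \<Longrightarrow> i \<in> A \<Longrightarrow> s \<in> {1..n i} \<Longrightarrow> z \<in> M \<Longrightarrow> cinner y (S i s z) = 0"
  by (simp add: wandering_def)

lemma wandering_subset: "wandering A M \<subseteq> M"
  by (auto simp: wandering_def)

lemma wandering_empty: "wandering {} M = M"
  by (auto simp: wandering_def)

lemma closed_csubspace_wandering:
  assumes "closed_csubspace M"
  shows "closed_csubspace (wandering A M)"
proof -
  have "wandering A M = {y \<in> M. \<forall>z \<in> {S i s z | i s z. i \<in> A \<and> s \<in> {1..n i} \<and> z \<in> M}. cinner y z = 0}"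
    unfolding wandering_def by blast
  then show ?thesis by (simp only: closed_csubspace_orthogonal_in[OF assms])
qed

lemma norm_row_shift:
  assumes i: "i \<in> {1..k}" and x: "\<And>s. s \<in> {1..n i} \<Longrightarrow> x s \<in> l2_tensor W UNIV"
  shows "(norm (\<Sum>s = 1..n i. S i s (x s)))\<^sup>2 = (\<Sum>s = 1..n i. (norm (x s))\<^sup>2)"
proof -
  have "(norm (\<Sum>s = 1..n i. S i s (x s)))\<^sup>2 = (\<Sum>s = 1..n i. (norm (S i s (x s)))\<^sup>2)"
    using i x
    by (intro norm_sum_Pythagorean)
      (auto simp: pairwise_def orthogonal_def cinner_shift_shift simp flip: Re_cinner)
  also have "\<dots> = (\<Sum>s = 1..n i. (norm (x s))\<^sup>2)"
    using i x by (intro sum.cong) (auto simp: norm_shift)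
  finally show ?thesis .
qed

text \<open>For \<open>N\<close> inside \<open>l2_tensor W UNIV\<close> the isometries
  \<open>S i s\<close> have orthogonal ranges, so the subtracted sum is the projection of
  \<open>y\<close> onto the sum of the \<open>S i s\<close> images of \<open>N\<close>.\<close>

definition residual ::
    "(words, 'a::chilbert_space) l2 set \<Rightarrow> nat \<Rightarrow> (words, 'a) l2 \<Rightarrow> (words, 'a) l2" where
  "residual N i y = y - (\<Sum>s = 1..n i. S i s (orth_proj N (coshift i s y)))"

lemma cinner_residual_shift:
  assumes N: "closed_csubspace N" "N \<subseteq> l2_tensor W UNIV" and r: "letter i r" and z: "z \<in> N"
  shows "cinner (residual N i y) (S i r z) = 0"
proof -
  have u: "orth_proj N (coshift i s y) \<in> l2_tensor W UNIV" for s
    using orth_proj_in[OF N(1)] N(2) by blast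
  have "cinner (\<Sum>s = 1..n i. S i s (orth_proj N (coshift i s y))) (S i r z) =
      (\<Sum>s = 1..n i. if s = r then cinner (orth_proj N (coshift i s y)) z else 0)"
    unfolding cinner_sum_left using r u by (intro sum.cong) (auto simp: cinner_shift_shift)
  also have "\<dots> = cinner (orth_proj N (coshift i r y)) z" using r by simp
  also have "\<dots> = cinner y (S i r z)"
    by (simp add: cinner_orth_proj_left[OF N(1) z] cinner_shift_right[OF r])
  finally show ?thesis by (simp add: residual_def cinner_diff_left)
qed

lemma residual_in:
  assumes "closed_csubspace N" "\<And>s x. s \<in> {1..n i} \<Longrightarrow> x \<in> N \<Longrightarrow> S i s x \<in> N" "y \<in> N"
  shows "residual N i y \<in> N"
  unfolding residual_def using assms
  by (intro closed_csubspace_diff closed_csubspace_sum) (auto simp: orth_proj_in)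

lemma residual_in_wandering:
  assumes "closed_csubspace N" "N \<subseteq> l2_tensor W UNIV" "i \<in> {1..k}"
    and "\<And>s x. s \<in> {1..n i} \<Longrightarrow> x \<in> N \<Longrightarrow> S i s x \<in> N" "y \<in> N"
  shows "residual N i y \<in> wandering {i} N"
  using residual_in[of N i y] cinner_residual_shift[of N i] assms by (auto simp: wandering_def)

text \<open>Since \<open>N\<close> is invariant under \<open>S i s\<close>, its orthogonal
  complement is invariant under \<open>coshift i s\<close>; so only the component of
  \<open>x\<close> in \<open>N\<close> contributes.\<close>

lemma orth_proj_coshift:
  assumes N: "closed_csubspace N" and i: "i \<in> {1..k}"
    and inv: "\<And>s x. s \<in> {1..n i} \<Longrightarrow> x \<in> N \<Longrightarrow> S i s x \<in> N" and s: "s \<in> {1..n i}"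
  shows "orth_proj N (coshift i s (orth_proj N x)) = orth_proj N (coshift i s (x :: (words, 'a::chilbert_space) l2))"
proof (rule orth_proj_unique[OF N])
  have "letter i s" using i s by blast
  then show "\<forall>z\<in>N. cinner (coshift i s (orth_proj N x) - orth_proj N (coshift i s x)) z = 0"
    using inv[OF s]
    by (simp add: cinner_diff_left cinner_orth_proj_left[OF N] cinner_shift_right[symmetric])
qed (rule orth_proj_in[OF N])

text \<open>The projection \<open>y\<close> of \<open>x\<close> splits orthogonally into its
  residual, which is the projection of \<open>x\<close> onto the wandering subspace, and a row of
  shifted vectors, whose norm is known by \<open>norm_row_shift\<close>. Pythagoras gives the
  identity.\<close>

lemma norm_orth_proj_wandering:
  fixes x :: "(words, 'a::chilbert_space) l2"
  assumes N: "closed_csubspace N" "N \<subseteq> l2_tensor W UNIV" and i: "i \<in> {1..k}"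
    and inv: "\<And>s x. s \<in> {1..n i} \<Longrightarrow> x \<in> N \<Longrightarrow> S i s x \<in> N"
  shows "(norm (orth_proj N x))\<^sup>2 - (\<Sum>s = 1..n i. (norm (orth_proj N (coshift i s x)))\<^sup>2) =
    (norm (orth_proj (wandering {i} N) x))\<^sup>2"
proof -
  define y where "y = orth_proj N x"
  define u where "u s = orth_proj N (coshift i s x)" for s
  have uN: "u s \<in> N" for s unfolding u_def by (rule orth_proj_in[OF N(1)])
  have yN: "y \<in> N" unfolding y_def by (rule orth_proj_in[OF N(1)])
  have res: "residual N i y = y - (\<Sum>s = 1..n i. S i s (u s))"
    unfolding residual_def u_def y_def
    by (intro arg_cong2[where f = minus] refl sum.cong arg_cong[where f = "S i _"]
        orth_proj_coshift[OF N(1) i inv])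
  have w: "residual N i y \<in> wandering {i} N"
    by (rule residual_in_wandering[OF N i inv yN])
  have orth: "cinner z (\<Sum>s = 1..n i. S i s (u s)) = 0" if "z \<in> wandering {i} N" for z
    unfolding cinner_sum_right using wanderingD[OF that] uN by (intro sum.neutral) auto
  have "orth_proj (wandering {i} N) x = residual N i y"
  proof (rule orth_proj_unique[OF closed_csubspace_wandering[OF N(1)] w], rule ballI)
    fix z assume z: "z \<in> wandering {i} N"
    then have "z \<in> N" using wandering_subset by blast
    then have "cinner (x - y) z = 0" unfolding y_def by (rule cinner_diff_orth_proj[OF N(1)])
    then show "cinner (x - residual N i y) z = 0"
      using orth[OF z] by (simp add: res cinner_diff_left cinner_eq_0_commute[of _ z])
  qed
  moreover have "(norm (residual N i y + (\<Sum>s = 1..n i. S i s (u s))))\<^sup>2 =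
      (norm (residual N i y))\<^sup>2 + (norm (\<Sum>s = 1..n i. S i s (u s)))\<^sup>2"
    by (rule norm_add_sq_cinner[OF orth[OF w]])
  moreover have "(norm (\<Sum>s = 1..n i. S i s (u s)))\<^sup>2 = (\<Sum>s = 1..n i. (norm (u s))\<^sup>2)"
    using uN N(2) by (intro norm_row_shift[OF i]) auto
  ultimately show ?thesis by (simp add: res u_def flip: y_def)
qed

definition wandering_invariant :: "(words, 'a::complex_inner) l2 set \<Rightarrow> bool" where
  "wandering_invariant M \<longleftrightarrow> (\<forall>i\<in>{1..k}. \<forall>j\<in>{1..k}. i \<noteq> j \<longrightarrow>
     (\<forall>t\<in>{1..n j}. \<forall>y\<in>wandering {i} M. S j t y \<in> wandering {i} M))"

end

section \<open>Double commutation on an invariant subspace\<close>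

locale invariant_subspace = shift_model +
  fixes M :: "(words, 'a::chilbert_space) l2 set"
  assumes closed: "closed_csubspace M" and subset: "M \<subseteq> l2_tensor W UNIV"
    and shift_in: "\<And>i s x. letter i s \<Longrightarrow> x \<in> M \<Longrightarrow> S i s x \<in> M"
begin

text \<open>Orthogonality of \<open>y\<close> to \<open>S i s\<close> applied to \<open>M\<close>
  can be tested on the single vector \<open>orth_proj M (coshift i s y)\<close>.\<close>

lemma wandering_mem_iff:
  assumes "A \<subseteq> {1..k}"
  shows "y \<in> wandering A M \<longleftrightarrow>
    y \<in> M \<and> (\<forall>i\<in>A. \<forall>s\<in>{1..n i}. orth_proj M (coshift i s y) = 0)"
proof -
  have "(\<forall>z\<in>M. cinner y (S i s z) = 0) \<longleftrightarrow> orth_proj M (coshift i s y) = 0"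
    if "i \<in> A" "s \<in> {1..n i}" for i s
  proof -
    have ls: "letter i s" using that assms by auto
    have *: "cinner y (S i s z) = cinner (orth_proj M (coshift i s y)) z" if "z \<in> M" for z
      by (simp add: cinner_shift_right[OF ls] cinner_orth_proj_left[OF closed that])
    show ?thesis
    proof
      assume "\<forall>z\<in>M. cinner y (S i s z) = 0"
      then have "cinner (orth_proj M (coshift i s y)) (orth_proj M (coshift i s y)) = 0"
        using * orth_proj_in[OF closed] by simp
      then show "orth_proj M (coshift i s y) = 0" by simp
    qed (use * in simp)
  qed
  then show ?thesis unfolding wandering_def by blast
qed

text \<open>\<open>M\<close> may fail to be invariant under \<open>coshift\<close>, so the adjoint
  within \<open>M\<close> is a compression.\<close>

lemma adjoint_on_restrict_shift:
  assumes ls: "letter i s"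
  shows "adjoint_on M (restrict (S i s) M) y = orth_proj M (coshift i s y)"
  by (rule adjoint_on_eqI[OF closed orth_proj_in[OF closed]])
    (simp add: cinner_shift[OF ls] cinner_orth_proj_right[OF closed])

text \<open>Split \<open>x\<close> into its residual and terms \<open>S i r (u r)\<close>.
  Invariance keeps \<open>S j t\<close> of the residual orthogonal to \<open>S i s z\<close>; in the
  remaining terms \<open>S j t\<close> passes \<open>S i r\<close>, and only \<open>r = s\<close>
  survives.\<close>

lemma orth_proj_coshift_shift:
  assumes inv: "wandering_invariant M" and ls: "letter i s" and lt: "letter j t" and ij: "i \<noteq> j"
    and x: "x \<in> M"
  shows "orth_proj M (coshift i s (S j t x)) = cnj (lam i j s t) *\<^sub>C S j t (orth_proj M (coshift i s x))"
proof (rule orth_proj_unique[OF closed], goal_cases)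
  case 1
  show ?case
    by (intro closed_csubspace_scaleC[OF closed] shift_in[OF lt] orth_proj_in[OF closed])
next
  case 2
  show ?case
  proof
    fix z assume z: "z \<in> M"
    define u where "u r = orth_proj M (coshift i r x)" for r
    have u: "u r \<in> M" for r unfolding u_def by (rule orth_proj_in[OF closed])
    have "residual M i x \<in> wandering {i} M"
      using ls by (intro residual_in_wandering[OF closed subset _ _ x] shift_in) auto
    then have "S j t (residual M i x) \<in> wandering {i} M"
      using inv ls lt ij unfolding wandering_invariant_def by blast
    then have 0: "cinner (S j t (residual M i x)) (S i s z) = 0"
      using ls z by (auto intro: wanderingD)
    have "x = residual M i x + (\<Sum>r = 1..n i. S i r (u r))"
      by (simp add: residual_def u_def)
    then have "S j t x = S j t (residual M i x) + (\<Sum>r = 1..n i. S j t (S i r (u r)))"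
      by (metis shift_add[OF lt] shift_sum[OF lt])
    then have "cinner (S j t x) (S i s z) = (\<Sum>r = 1..n i. cinner (S j t (S i r (u r))) (S i s z))"
      using 0 by (simp add: cinner_add_left cinner_sum_left)
    also have "\<dots> = (\<Sum>r = 1..n i. if r = s then lam j i t s * cinner (S j t (u s)) z else 0)"
    proof (rule sum.cong)
      fix r assume "r \<in> {1..n i}"
      then have lr: "letter i r" using ls by auto
      have "S j t (u r) \<in> l2_tensor W UNIV" using shift_in[OF lt u] subset by blast
      then show "cinner (S j t (S i r (u r))) (S i s z) =
          (if r = s then lam j i t s * cinner (S j t (u s)) z else 0)"
        using ij by (auto simp: shift_shift[OF lt lr] cinner_scaleC_left cinner_shift_shift[OF lr ls])
    qed simp
    also have "\<dots> = cnj (lam i j s t) * cinner (S j t (u s)) z"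
      using ls lam_mult(1)[OF ls lt ij] by simp
    finally show "cinner (coshift i s (S j t x) -
        cnj (lam i j s t) *\<^sub>C S j t (orth_proj M (coshift i s x))) z = 0"
      by (simp add: cinner_diff_left cinner_scaleC_left cinner_shift_right[OF ls] u_def)
  qed
qed

text \<open>A vector is wandering for \<open>i\<close> when the adjoints of the restricted
  \<open>S i s\<close> kill it, and the commutation relation carries this over to its image under
  \<open>S j t\<close>. The converse is \<open>orth_proj_coshift_shift\<close>; the row isometries
  come from the model.\<close>

lemma doubly_Lambda_commuting_iff:
  "doubly_Lambda_commuting k n lam M (\<lambda>i s. restrict (S i s) M) \<longleftrightarrow> wandering_invariant M"
proof
  assume dc: "doubly_Lambda_commuting k n lam M (\<lambda>i s. restrict (S i s) M)"
  show "wandering_invariant M"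
    unfolding wandering_invariant_def
  proof (intro ballI impI)
    fix i j t y assume i: "i \<in> {1..k}" and jt: "j \<in> {1..k}" "i \<noteq> j" "t \<in> {1..n j}"
      and y: "y \<in> wandering {i} M"
    have yM: "y \<in> M" and y0: "\<And>s. s \<in> {1..n i} \<Longrightarrow> orth_proj M (coshift i s y) = 0"
      using y i by (auto simp: wandering_mem_iff)
    have Sy: "S j t y \<in> M" using shift_in jt yM by blast
    have "orth_proj M (coshift i s (S j t y)) = 0" if s: "s \<in> {1..n i}" for s
    proof -
      have ls: "letter i s" and lt: "letter j t" using i s jt by auto
      have "adjoint_on M (restrict (S i s) M) (restrict (S j t) M y) =
          cnj (lam i j s t) *\<^sub>C restrict (S j t) M (adjoint_on M (restrict (S i s) M) y)"
        using dc i jt s yM unfolding doubly_Lambda_commuting_def by blast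
      then show ?thesis
        using yM y0[OF s] closed_csubspace_0[OF closed]
        by (simp add: adjoint_on_restrict_shift[OF ls] shift_0[OF lt])
    qed
    then show "S j t y \<in> wandering {i} M" using i Sy by (auto simp: wandering_mem_iff)
  qed
next
  assume inv: "wandering_invariant M"
  have "bounded_op M M (restrict (S i s) M)" if ls: "letter i s" for i s
    unfolding bounded_op_def
    using subset closed
    by (auto simp: shift_in[OF ls] closed_csubspace_add closed_csubspace_scaleC shift_add[OF ls]
        shift_scaleC[OF ls] subset_iff norm_shift[OF ls] intro!: exI[of _ 1])
  moreover have "(norm (\<Sum>s = 1..n i. restrict (S i s) M (x s)))\<^sup>2 = (\<Sum>s = 1..n i. (norm (x s))\<^sup>2)"
    if "i \<in> {1..k}" "\<forall>s\<in>{1..n i}. x s \<in> M" for i x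
    using that subset norm_row_shift[of i x] by (simp add: subset_iff)
  ultimately have "row_isometry M (n i) (\<lambda>s. restrict (S i s) M)" if "i \<in> {1..k}" for i
    using that unfolding row_isometry_def by blast
  moreover have "adjoint_on M (restrict (S i s) M) (restrict (S j t) M x) =
      cnj (lam i j s t) *\<^sub>C restrict (S j t) M (adjoint_on M (restrict (S i s) M) x)"
    if "letter i s" "letter j t" "i \<noteq> j" "x \<in> M" for i j s t x
    using orth_proj_coshift_shift[OF inv that] that(4) orth_proj_in[OF closed, of "coshift i s x"]
    by (simp add: adjoint_on_restrict_shift[OF that(1)])
  ultimately show "doubly_Lambda_commuting k n lam M (\<lambda>i s. restrict (S i s) M)"
    unfolding doubly_Lambda_commuting_def by blast
qed

end

section \<open>Positivity of the defect\<close>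

context shift_model
begin

text \<open>The quadratic form of \<open>T - \<Phi>\<^sub>i(T)\<close> is \<open>form_diff i q\<close>, where \<open>q\<close> is the quadratic form of \<open>T\<close>.\<close>

definition form_diff ::
    "nat \<Rightarrow> ((words, 'a::complex_inner) l2 \<Rightarrow> real) \<Rightarrow> (words, 'a) l2 \<Rightarrow> real" where
  "form_diff i q x = q x - (\<Sum>s = 1..n i. q (coshift i s x))"

text \<open>Invariance under unimodular scalars hides the factors \<open>lam\<close>, so that the
  maps \<open>form_diff i\<close> commute; the quadratic bound makes tails vanish in the purity
  argument.\<close>

definition bounded_form :: "((words, 'a::complex_inner) l2 \<Rightarrow> real) \<Rightarrow> bool" where
  "bounded_form q \<longleftrightarrow> (\<forall>c x. cmod c = 1 \<longrightarrow> q (c *\<^sub>C x) = q x) \<and>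
     (\<exists>C\<ge>0. \<forall>x. \<bar>q x\<bar> \<le> C * (norm x)\<^sup>2)"

lemma bounded_form_form_diff:
  assumes q: "bounded_form q" and i: "i \<in> {1..k}"
  shows "bounded_form (form_diff i q)"
proof -
  obtain C where C: "C \<ge> 0" "\<And>x. \<bar>q x\<bar> \<le> C * (norm x)\<^sup>2"
    using q unfolding bounded_form_def by blast
  have "\<bar>form_diff i q x\<bar> \<le> (C + real (n i) * C) * (norm x)\<^sup>2" for x
  proof -
    have "\<bar>q (coshift i s x)\<bar> \<le> C * (norm x)\<^sup>2" if "s \<in> {1..n i}" for s
    proof -
      have "(norm (coshift i s x))\<^sup>2 \<le> (norm x)\<^sup>2"
        using norm_coshift_le[of i s x] i that by (intro power_mono) auto
      then show ?thesis using C(2)[of "coshift i s x"] C(1) by (meson mult_left_mono order_trans)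
    qed
    then have "(\<Sum>s = 1..n i. \<bar>q (coshift i s x)\<bar>) \<le> real (n i) * (C * (norm x)\<^sup>2)"
      using sum_mono[of "{1..n i}" "\<lambda>s. \<bar>q (coshift i s x)\<bar>" "\<lambda>_. C * (norm x)\<^sup>2"] by simp
    moreover have "\<bar>\<Sum>s = 1..n i. q (coshift i s x)\<bar> \<le> (\<Sum>s = 1..n i. \<bar>q (coshift i s x)\<bar>)"
      by (rule sum_abs)
    ultimately have "\<bar>form_diff i q x\<bar> \<le> C * (norm x)\<^sup>2 + real (n i) * (C * (norm x)\<^sup>2)"
      using C(2)[of x] unfolding form_diff_def by linarith
    then show ?thesis by (simp add: algebra_simps)
  qed
  then have "\<exists>C\<ge>0. \<forall>x. \<bar>form_diff i q x\<bar> \<le> C * (norm x)\<^sup>2"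
    using C(1) by (intro exI[of _ "C + real (n i) * C"]) auto
  moreover have "form_diff i q (c *\<^sub>C x) = form_diff i q x" if "cmod c = 1" for c x
    using q that i unfolding form_diff_def bounded_form_def by (simp add: coshift_scaleC)
  ultimately show ?thesis by (simp add: bounded_form_def)
qed

text \<open>The operators \<open>coshift i s\<close> and \<open>coshift j t\<close> commute up to a
  unimodular factor, to which \<open>q\<close> is blind.\<close>

lemma form_diff_commute:
  assumes q: "bounded_form q" and i: "i \<in> {1..k}" and j: "j \<in> {1..k}"
  shows "form_diff i (form_diff j q) = form_diff j (form_diff i q)"
proof (cases "i = j")
  case False
  have *: "q (coshift j t (coshift i s x)) = q (coshift i s (coshift j t x))"
    if "s \<in> {1..n i}" "t \<in> {1..n j}" for s t x
  proof -
    have ls: "letter i s" and lt: "letter j t" using that i j by auto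
    show ?thesis
      using q lam_mult(3)[OF ls lt False]
      by (simp add: bounded_form_def coshift_coshift[OF ls lt False])
  qed
  show ?thesis
  proof
    fix x
    have "(\<Sum>s = 1..n i. \<Sum>t = 1..n j. q (coshift j t (coshift i s x))) =
        (\<Sum>t = 1..n j. \<Sum>s = 1..n i. q (coshift i s (coshift j t x)))"
      by (subst sum.swap) (intro sum.cong refl *)
    then show "form_diff i (form_diff j q) x = form_diff j (form_diff i q) x"
      by (simp add: form_diff_def sum_subtractf)
  qed
qed simp

text \<open>Finitely many words carry almost all of the norm, and the lengths of their components
  \<open>i\<close> are bounded.\<close>

lemma tail_tendsto_0:
  fixes x :: "(words, 'a::complex_inner) l2"
  shows "(\<lambda>N. \<Sum>\<^sub>\<infinity>\<alpha>\<in>{\<alpha>\<in>W. N \<le> length (\<alpha> i)}. (norm (l2_apply x \<alpha>))\<^sup>2) \<longlonglongrightarrow> 0"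
    (is "?t \<longlonglongrightarrow> 0")
proof (rule metric_LIMSEQ_I)
  fix r :: real assume r: "r > 0"
  let ?q = "\<lambda>\<alpha>. (norm (l2_apply x \<alpha>))\<^sup>2"
  obtain F where F: "finite F" "F \<subseteq> UNIV" "dist (sum ?q F) (infsum ?q UNIV) \<le> r / 2"
    using infsum_finite_approximation[OF l2_summable[of x UNIV], of "r / 2"] r by auto
  obtain N where N: "\<And>\<alpha>. \<alpha> \<in> F \<Longrightarrow> length (\<alpha> i) < N"
  proof
    fix \<alpha> assume "\<alpha> \<in> F"
    then have "length (\<alpha> i) \<le> Max ((\<lambda>\<alpha>. length (\<alpha> i)) ` F)" using F(1) by (intro Max_ge) auto
    then show "length (\<alpha> i) < Suc (Max ((\<lambda>\<alpha>. length (\<alpha> i)) ` F))" by simp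
  qed
  have "dist (?t m) 0 < r" if m: "m \<ge> N" for m
  proof -
    have "?t m \<le> infsum ?q (UNIV - F)"
    proof (rule infsum_mono_neutral[OF l2_summable l2_summable])
      show "?q \<alpha> \<le> 0" if "\<alpha> \<in> {\<alpha> \<in> W. m \<le> length (\<alpha> i)} - (UNIV - F)" for \<alpha>
        using that N[of \<alpha>] m by auto
    qed auto
    also have "\<dots> = infsum ?q UNIV - infsum ?q F"
      by (rule infsum_Diff) (auto simp: l2_summable)
    also have "\<dots> < r" using F(1,3) r unfolding dist_real_def infsum_finite[OF F(1)] by linarith
    finally show ?thesis by (simp add: infsum_nonneg)
  qed
  then show "\<exists>N. \<forall>m\<ge>N. dist (?t m) 0 < r" by blast
qed

text \<open>The shifts are pure: iterating \<open>q x \<ge> \<Sum>\<^sub>s q (S\<^sub>i\<^sub>,\<^sub>s\<^sup>* x)\<close> leaves only a tail of \<open>x\<close>.\<close>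

lemma form_diff_nonnegD:
  fixes q :: "(words, 'a::complex_inner) l2 \<Rightarrow> real"
  assumes q: "bounded_form q" and i: "i \<in> {1..k}"
    and nonneg: "\<And>x. x \<in> l2_tensor W UNIV \<Longrightarrow> form_diff i q x \<ge> 0"
    and x: "x \<in> l2_tensor W UNIV"
  shows "q x \<ge> 0"
proof -
  obtain C where C: "C \<ge> 0" "\<And>x. \<bar>q x\<bar> \<le> C * (norm x)\<^sup>2"
    using q unfolding bounded_form_def by blast
  define t where "t N x = (\<Sum>\<^sub>\<infinity>\<alpha>\<in>{\<alpha>\<in>W. N \<le> length (\<alpha> i)}. (norm (l2_apply x \<alpha>))\<^sup>2)"
    for N and x :: "(words, 'a) l2"
  have t_0: "t 0 x = (norm x)\<^sup>2" if "x \<in> l2_tensor W UNIV" for x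
    unfolding t_def norm_l2_sq using that by (intro infsum_cong_neutral) (auto simp: l2_tensor_def)
  \<comment> \<open>Words whose component \<open>i\<close> has length at least \<open>Suc N\<close>
    are sorted by their first letter \<open>s\<close>; \<open>coshift i s\<close> strips that letter
    and keeps the norms of the coefficients.\<close>
  have t_Suc: "(\<Sum>s = 1..n i. t N (coshift i s x)) = t (Suc N) x" for N x
  proof -
    define B where "B s = {\<beta> \<in> W. \<exists>w. \<beta> i = s # w \<and> N \<le> length w}" for s
    have "t N (coshift i s x) = (\<Sum>\<^sub>\<infinity>\<beta>\<in>B s. (norm (l2_apply x \<beta>))\<^sup>2)" if s: "s \<in> {1..n i}" for s
    proof -
      have ls: "letter i s" using i s by auto
      let ?h = "\<lambda>\<alpha> :: words. \<alpha>(i := s # \<alpha> i)"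
      have "B s = ?h ` {\<alpha>\<in>W. N \<le> length (\<alpha> i)}"
      proof (intro equalityI subsetI)
        fix \<beta> assume "\<beta> \<in> B s"
        then obtain w where w: "\<beta> \<in> W" "\<beta> i = s # w" "N \<le> length w" by (auto simp: B_def)
        then show "\<beta> \<in> ?h ` {\<alpha>\<in>W. N \<le> length (\<alpha> i)}"
          using Words_tl[OF w(1) i w(2)]
          by (intro image_eqI[of _ _ "\<beta>(i := w)"]) (auto simp: fun_upd_idem)
      qed (use Words_Cons[OF ls] in \<open>auto simp: B_def\<close>)
      then have "(\<Sum>\<^sub>\<infinity>\<beta>\<in>B s. (norm (l2_apply x \<beta>))\<^sup>2) =
          (\<Sum>\<^sub>\<infinity>\<alpha>\<in>{\<alpha>\<in>W. N \<le> length (\<alpha> i)}. (norm (l2_apply x (?h \<alpha>)))\<^sup>2)"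
        by (simp add: infsum_reindex[OF inj_Cons_upd] o_def)
      also have "\<dots> = t N (coshift i s x)"
        unfolding t_def using ls
        by (intro infsum_cong) (simp add: l2_apply_coshift norm_scaleC cmod_phase[OF Lambda])
      finally show ?thesis by simp
    qed
    then have "(\<Sum>s = 1..n i. t N (coshift i s x)) = (\<Sum>s = 1..n i. \<Sum>\<^sub>\<infinity>\<beta>\<in>B s. (norm (l2_apply x \<beta>))\<^sup>2)"
      by (intro sum.cong) auto
    also have "\<dots> = (\<Sum>\<^sub>\<infinity>\<beta>\<in>(\<Union>s\<in>{1..n i}. B s). (norm (l2_apply x \<beta>))\<^sup>2)"
      by (rule sum_infsum) (auto simp: B_def l2_summable)
    also have "(\<Union>s\<in>{1..n i}. B s) = {\<beta>\<in>W. Suc N \<le> length (\<beta> i)}"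
      using Words_tl(2)[OF _ i] by (auto simp: B_def Suc_le_length_iff)
    finally show ?thesis by (simp add: t_def)
  qed
  have "- C * t N x \<le> q x" if "x \<in> l2_tensor W UNIV" for N x
    using that
  proof (induction N arbitrary: x)
    case 0
    then show ?case using C(2)[of x] by (simp add: t_0 abs_le_iff)
  next
    case (Suc N)
    have "- C * t (Suc N) x = (\<Sum>s = 1..n i. - C * t N (coshift i s x))"
      unfolding t_Suc[symmetric] by (simp only: sum_distrib_left)
    also have "\<dots> \<le> (\<Sum>s = 1..n i. q (coshift i s x))"
      using i by (intro sum_mono Suc.IH coshift_in_l2_tensor closed_csubspace_UNIV) auto
    also have "\<dots> \<le> q x" using nonneg[OF Suc.prems] by (simp add: form_diff_def)
    finally show ?case .
  qed
  moreover have "(\<lambda>N. - C * t N x) \<longlonglongrightarrow> - C * 0"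
    unfolding t_def by (intro tendsto_intros tail_tendsto_0)
  ultimately show ?thesis using x LIMSEQ_le_const2[of "\<lambda>N. - C * t N x" 0 "q x"] by auto
qed

lemma bounded_form_foldr:
  "bounded_form q \<Longrightarrow> set is \<subseteq> {1..k} \<Longrightarrow> bounded_form (foldr form_diff is q)"
  by (induction "is") (auto intro: bounded_form_form_diff)

lemma foldr_form_diff_commute:
  assumes "bounded_form q" "i \<in> {1..k}" "set is \<subseteq> {1..k}"
  shows "form_diff i (foldr form_diff is q) = foldr form_diff is (form_diff i q)"
  using assms(3)
proof (induction "is")
  case (Cons j "is")
  then show ?case
    using form_diff_commute[OF bounded_form_foldr[OF assms(1)], of "is" i j] assms(2) by simp
qed simp

text \<open>As the factors commute, any one of them may be made to act first on
  \<open>q\<close>.\<close>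

lemma foldr_form_diff_remove1:
  assumes "bounded_form q" "set is \<subseteq> {1..k}" "i \<in> set is"
  shows "foldr form_diff is q = foldr form_diff (remove1 i is) (form_diff i q)"
  using assms(2,3)
proof (induction "is")
  case (Cons j "is")
  then show ?case using foldr_form_diff_commute[OF assms(1), of j "is"] by auto
qed simp

text \<open>Purity, in the form of \<open>form_diff_nonnegD\<close>, strips off the outermost factor
  at each step.\<close>

lemma foldr_form_diff_nonnegD:
  assumes "bounded_form q" "set is \<subseteq> {1..k}"
    and "\<And>x. x \<in> l2_tensor W UNIV \<Longrightarrow> foldr form_diff is q x \<ge> 0"
    and "x \<in> l2_tensor W UNIV"
  shows "q x \<ge> 0"
  using assms(2-)
proof (induction "is" arbitrary: x)
  case (Cons j "is")
  have "foldr form_diff is q y \<ge> 0" if "y \<in> l2_tensor W UNIV" for y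
    by (rule form_diff_nonnegD[OF bounded_form_foldr[OF assms(1)] _ _ that])
      (use Cons.prems in auto)
  then show ?case using Cons.IH Cons.prems by simp
qed simp

text \<open>Positivity concerns only the diagonal values \<open>cinner (T x) x\<close>, and moving
  \<open>S i s\<close> to the other side turns the value of a conjugated operator at
  \<open>x\<close> into the value of the operator at \<open>coshift i s x\<close>.\<close>

lemma cinner_foldr_row_cp_map:
  assumes T: "\<And>x. x \<in> l2_tensor W UNIV \<Longrightarrow> cinner (T x) x = complex_of_real (q x)"
    and "set is \<subseteq> {1..k}" and "x \<in> l2_tensor W UNIV"
  shows "cinner (foldr (\<lambda>i T x. T x - row_cp_map (l2_tensor W UNIV) (n i) (S i) T x) is T x) x =
    complex_of_real (foldr form_diff is q x)"
  using assms(2-)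
proof (induction "is" arbitrary: x)
  case (Cons i "is")
  define R where "R = foldr (\<lambda>i T x. T x - row_cp_map (l2_tensor W UNIV) (n i) (S i) T x) is T"
  have R: "cinner (R y) y = complex_of_real (foldr form_diff is q y)" if "y \<in> l2_tensor W UNIV" for y
    using Cons that by (simp add: R_def)
  have "cinner (S i s (R (adjoint_on (l2_tensor W UNIV) (S i s) x))) x =
      complex_of_real (foldr form_diff is q (coshift i s x))" if "s \<in> {1..n i}" for s
  proof -
    have ls: "letter i s" using Cons.prems that by auto
    have c: "coshift i s x \<in> l2_tensor W UNIV"
      by (rule coshift_in_l2_tensor[OF ls closed_csubspace_UNIV]) simp
    then have "adjoint_on (l2_tensor W UNIV) (S i s) x = coshift i s x"
      by (intro adjoint_on_eqI closed_csubspace_l2_tensor closed_csubspace_UNIV cinner_shift[OF ls])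
    then show ?thesis using R[OF c] by (simp add: cinner_shift[OF ls])
  qed
  then have "cinner (row_cp_map (l2_tensor W UNIV) (n i) (S i) R x) x =
      (\<Sum>s = 1..n i. complex_of_real (foldr form_diff is q (coshift i s x)))"
    unfolding row_cp_map_def cinner_sum_left by (intro sum.cong) auto
  then show ?case
    using R[OF Cons.prems(2)]
    by (simp add: form_diff_def[of i "foldr form_diff is q" x] cinner_diff_left flip: R_def)
qed (use T in simp)

end

section \<open>The defect of the projection onto an invariant subspace\<close>

context invariant_subspace
begin

definition proj_form :: "(words, 'a) l2 \<Rightarrow> real" where
  "proj_form x = (norm (orth_proj M x))\<^sup>2"

lemma bounded_form_proj_form: "bounded_form proj_form"
proof -
  have "proj_form x \<le> (norm x)\<^sup>2" for x
    unfolding proj_form_def by (intro power_mono norm_orth_proj_le[OF closed]) simp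
  then have "\<exists>C\<ge>0. \<forall>x. \<bar>proj_form x\<bar> \<le> C * (norm x)\<^sup>2"
    by (intro exI[of _ 1]) (simp add: proj_form_def)
  then show ?thesis
    by (simp add: bounded_form_def proj_form_def orth_proj_scaleC[OF closed] norm_scaleC)
qed

lemma positive_defect_iff:
  "positive_op (l2_tensor W UNIV) (defect_map (l2_tensor W UNIV) k n S (orth_proj M)) \<longleftrightarrow>
    (\<forall>x\<in>l2_tensor W UNIV. foldr form_diff [1..<Suc k] proj_form x \<ge> 0)"
proof -
  have "cinner (orth_proj M x) x = complex_of_real (proj_form x)" for x
    using cinner_orth_proj_right[OF closed orth_proj_in[OF closed], of x x]
    by (simp add: proj_form_def cinner_self)
  then have "cinner (defect_map (l2_tensor W UNIV) k n S (orth_proj M) x) x =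
      complex_of_real (foldr form_diff [1..<Suc k] proj_form x)"
    if "x \<in> l2_tensor W UNIV" for x
    unfolding defect_map_def using that by (intro cinner_foldr_row_cp_map) auto
  then show ?thesis unfolding positive_op_def by (simp del: upt_Suc)
qed

lemma wandering_invariant_if_positive:
  assumes pos: "\<And>x. x \<in> l2_tensor W UNIV \<Longrightarrow> foldr form_diff [1..<Suc k] proj_form x \<ge> 0"
  shows "wandering_invariant M"
  unfolding wandering_invariant_def
proof (intro ballI impI)
  fix i j t y assume i: "i \<in> {1..k}" and j: "j \<in> {1..k}" "i \<noteq> j" and t: "t \<in> {1..n j}"
    and y: "y \<in> wandering {i} M"
  define p where "p = form_diff i proj_form"
  have p: "p x = (norm (orth_proj (wandering {i} M) x))\<^sup>2" for x
    unfolding p_def form_diff_def proj_form_def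
    using i by (intro norm_orth_proj_wandering[OF closed subset] shift_in) auto
  have p_bounded: "bounded_form p"
    unfolding p_def by (rule bounded_form_form_diff[OF bounded_form_proj_form i])
  have "form_diff j p x \<ge> 0" if "x \<in> l2_tensor W UNIV" for x
  proof (rule foldr_form_diff_nonnegD[OF _ _ _ that])
    \<comment> \<open>With the factors for \<open>i\<close> and \<open>j\<close> moved innermost,
      these are the remaining ones, to be stripped off by purity.\<close>
    let ?is = "remove1 j (remove1 i [1..<Suc k])"
    show "bounded_form (form_diff j p)" by (rule bounded_form_form_diff[OF p_bounded j(1)])
    show *: "set ?is \<subseteq> {1..k}" 
      using set_remove1_subset[of j "remove1 i [1..<Suc k]"] set_remove1_subset[of i "[1..<Suc k]"]
      by (auto simp del: upt_Suc)
    fix x :: "(words, 'a) l2" assume x: "x \<in> l2_tensor W UNIV"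
    have "foldr form_diff [1..<Suc k] proj_form = foldr form_diff (remove1 i [1..<Suc k]) p"
      unfolding p_def using i by (intro foldr_form_diff_remove1[OF bounded_form_proj_form]) auto
    also have "\<dots> = foldr form_diff ?is (form_diff j p)"
      using i j by (intro foldr_form_diff_remove1[OF p_bounded]) auto
    finally show "foldr form_diff ?is (form_diff j p) x \<ge> 0" using pos[OF x] by simp
  qed
  then have dec: "(\<Sum>r = 1..n j. p (coshift j r x)) \<le> p x" if "x \<in> l2_tensor W UNIV" for x
    using that by (simp add: form_diff_def)
  have lt: "letter j t" using j t by auto
  have yM: "y \<in> M" using y wandering_subset by blast
  have Sy: "S j t y \<in> M" using shift_in[OF lt yM] .
  have "orth_proj M (coshift i s (S j t y)) = 0" if s: "s \<in> {1..n i}" for s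
  proof -
    have ls: "letter i s" using i s by auto
    \<comment> \<open>The vector claimed to vanish. Its shift \<open>S i s u\<close> is orthogonal
      to \<open>wandering {i} M\<close>, so \<open>p\<close> is zero there, and by
      \<open>dec\<close> every term \<open>p (coshift j r (S i s u))\<close> is zero as
      well.\<close>
    define u where "u = orth_proj M (coshift i s (S j t y))"
    have u: "u \<in> M" unfolding u_def by (rule orth_proj_in[OF closed])
    have x: "S i s u \<in> l2_tensor W UNIV" using shift_in[OF ls u] subset by blast
    have "orth_proj (wandering {i} M) (S i s u) = 0"
      using u s closed_csubspace_0[OF closed_csubspace_wandering[OF closed]] wanderingD[of _ "{i}" M i s u]
      by (intro orth_proj_unique[OF closed_csubspace_wandering[OF closed]])
        (auto simp: cinner_eq_0_commute[of "S i s u"])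
    then have "p (S i s u) = 0" by (simp add: p)
    then have "(\<Sum>r = 1..n j. p (coshift j r (S i s u))) \<le> 0" using dec[OF x] by simp
    moreover have "p (coshift j t (S i s u)) \<le> (\<Sum>r = 1..n j. p (coshift j r (S i s u)))"
      by (rule member_le_sum[OF t]) (auto simp: p)
    ultimately have "p (coshift j t (S i s u)) \<le> 0" by linarith
    then have "orth_proj (wandering {i} M) (coshift j t (S i s u)) = 0"
      by (simp add: p)
    then have "cinner (coshift j t (S i s u)) y = 0"
      using cinner_orth_proj_left[OF closed_csubspace_wandering[OF closed] y, of "coshift j t (S i s u)"]
      by simp
    \<comment> \<open>Since \<open>u\<close> is the projection of the second argument onto
      \<open>M\<close>, this inner product is that of \<open>u\<close> with itself.\<close>
    then have "cinner u (coshift i s (S j t y)) = 0"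
      by (simp add: cinner_shift[OF ls] flip: cinner_shift_right[OF lt])
    then have "cinner u u = 0"
      unfolding u_def by (metis cinner_orth_proj_right[OF closed orth_proj_in[OF closed]])
    then show ?thesis by (simp add: u_def)
  qed
  then show "S j t y \<in> wandering {i} M" using i Sy by (auto simp: wandering_mem_iff)
qed

text \<open>Against \<open>S j r z\<close> the compressed adjoint yields \<open>y\<close> against
  \<open>S i s (S j r z)\<close>, a multiple of \<open>S j r (S i s z)\<close>, and
  \<open>S i s z\<close> is again in \<open>M\<close>.\<close>

lemma orth_proj_coshift_in_wandering:
  assumes A: "A \<subseteq> {1..k}" and ls: "letter i s" "i \<notin> A" and y: "y \<in> wandering A M"
  shows "orth_proj M (coshift i s y) \<in> wandering A M"
proof -
  have "cinner (orth_proj M (coshift i s y)) (S j r z) = 0"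
    if j: "j \<in> A" and r: "r \<in> {1..n j}" and z: "z \<in> M" for j r z
  proof -
    have lr: "letter j r" and ij: "i \<noteq> j" using j r A ls by auto
    have "cinner (orth_proj M (coshift i s y)) (S j r z) = cinner y (lam i j s r *\<^sub>C S j r (S i s z))"
      by (simp add: cinner_orth_proj_left[OF closed shift_in[OF lr z]]
          flip: cinner_shift_right[OF ls(1)] shift_shift[OF ls(1) lr ij])
    also have "\<dots> = 0"
      using wanderingD[OF y j r shift_in[OF ls(1) z]] by (simp add: cinner_scaleC_right)
    finally show ?thesis .
  qed
  then show ?thesis using orth_proj_in[OF closed] by (simp add: wandering_def)
qed

text \<open>The left side tests \<open>y\<close> only against shifts of
  \<open>wandering A M\<close>. This suffices, because the decisive test vector
  \<open>orth_proj M (coshift i s y)\<close> lies in \<open>wandering A M\<close>.\<close>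

lemma wandering_insert:
  assumes A: "A \<subseteq> {1..k}" and i: "i \<in> {1..k}" "i \<notin> A"
  shows "wandering {i} (wandering A M) = wandering (insert i A) M"
proof
  show "wandering (insert i A) M \<subseteq> wandering {i} (wandering A M)"
    unfolding wandering_def by blast
  show "wandering {i} (wandering A M) \<subseteq> wandering (insert i A) M"
  proof
    fix y assume y: "y \<in> wandering {i} (wandering A M)"
    then have yA: "y \<in> wandering A M" using wandering_subset by blast
    have "orth_proj M (coshift i s y) = 0" if s: "s \<in> {1..n i}" for s
    proof -
      have ls: "letter i s" using i s by auto
      define u where "u = orth_proj M (coshift i s y)"
      have "u \<in> wandering A M"
        unfolding u_def by (rule orth_proj_coshift_in_wandering[OF A ls i(2) yA])
      then have "cinner y (S i s u) = 0" using wanderingD[OF y _ s] by simp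
      then have "cinner u u = 0"
        unfolding u_def using orth_proj_in[OF closed]
        by (simp add: cinner_orth_proj_left[OF closed] cinner_shift_right[OF ls])
      then show ?thesis by (simp add: u_def)
    qed
    then show "y \<in> wandering (insert i A) M"
      using yA A i by (auto simp: wandering_mem_iff)
  qed
qed

lemma shift_in_wandering:
  assumes inv: "wandering_invariant M" and A: "A \<subseteq> {1..k}" and ls: "letter i s" "i \<notin> A"
    and y: "y \<in> wandering A M"
  shows "S i s y \<in> wandering A M"
proof -
  have yM: "y \<in> M" using y wandering_subset by blast
  have "S i s y \<in> wandering {j} M" if "j \<in> A" for j
  proof -
    have "y \<in> wandering {j} M" using y that by (simp add: wandering_def)
    moreover have "j \<noteq> i" "j \<in> {1..k}" using that A ls by auto
    ultimately show ?thesis using inv ls unfolding wandering_invariant_def by blast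
  qed
  then show ?thesis using shift_in[OF ls(1) yM] by (simp add: wandering_def)
qed

text \<open>Each factor adds its index to the wandering subspace, by
  \<open>norm_orth_proj_wandering\<close> with \<open>N = wandering (set is) M\<close>. Distinctness
  ensures that this \<open>N\<close> is invariant under the shifts of the new index.\<close>

lemma foldr_proj_form:
  assumes inv: "wandering_invariant M" and "set is \<subseteq> {1..k}" "distinct is"
  shows "foldr form_diff is proj_form = (\<lambda>x. (norm (orth_proj (wandering (set is) M) x))\<^sup>2)"
  using assms(2-)
proof (induction "is")
  case Nil
  then show ?case by (simp add: wandering_empty proj_form_def fun_eq_iff)
next
  case (Cons i "is")
  show ?case
  proof
    fix x
    have "(norm (orth_proj (wandering (set is) M) x))\<^sup>2 -
        (\<Sum>s = 1..n i. (norm (orth_proj (wandering (set is) M) (coshift i s x)))\<^sup>2) =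
        (norm (orth_proj (wandering {i} (wandering (set is) M)) x))\<^sup>2"
      using Cons.prems subset wandering_subset[of "set is" M]
      by (intro norm_orth_proj_wandering closed_csubspace_wandering closed shift_in_wandering[OF inv]) auto
    also have "wandering {i} (wandering (set is) M) = wandering (set (i # is)) M"
      using Cons.prems by (simp add: wandering_insert)
    finally show "foldr form_diff (i # is) proj_form x =
        (norm (orth_proj (wandering (set (i # is)) M) x))\<^sup>2"
      using Cons by (simp add: form_diff_def[of i _ x])
  qed
qed

lemma positive_iff_wandering_invariant:
  "positive_op (l2_tensor W UNIV) (defect_map (l2_tensor W UNIV) k n S (orth_proj M)) \<longleftrightarrow>
    wandering_invariant M"
proof
  assume "wandering_invariant M"
  then have "foldr form_diff [1..<Suc k] proj_form x \<ge> 0" for x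
    by (subst foldr_proj_form) auto
  then show "positive_op (l2_tensor W UNIV) (defect_map (l2_tensor W UNIV) k n S (orth_proj M))"
    by (simp only: positive_defect_iff) simp
qed (simp only: positive_defect_iff wandering_invariant_if_positive)

end

section \<open>Beurling type subspaces\<close>

text \<open>\<open>\<Psi>\<close> is isometric on \<open>N\<close>, the orthogonal complement of its kernel. Since the shifts are isometries
  commuting with \<open>\<Psi>\<close>, both the kernel and \<open>N\<close> are invariant, so that \<open>N\<close> is reducing.\<close>

lemma (in invariant_subspace) wandering_invariant_if_inner:
  fixes L :: "'l::chilbert_space set" and \<Psi> :: "(words, 'l) l2 \<Rightarrow> (words, 'a) l2"
  assumes L: "closed_csubspace L" and \<Psi>: "inner_multi_analytic k n lam L \<Psi>"
    and M: "M = \<Psi> ` l2_tensor W L"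
  shows "wandering_invariant M"
proof -
  define D where "D = l2_tensor W L"
  have D: "closed_csubspace D" unfolding D_def by (rule closed_csubspace_l2_tensor[OF L])
  have DH: "D \<subseteq> l2_tensor W UNIV" by (auto simp: D_def l2_tensor_def)
  have bop: "bounded_op D (l2_tensor W UNIV) \<Psi>"
    and comm: "\<And>i s f. letter i s \<Longrightarrow> f \<in> D \<Longrightarrow> \<Psi> (S i s f) = S i s (\<Psi> f)"
    and part: "partial_isometry_on D \<Psi>"
    using \<Psi> by (auto simp: inner_multi_analytic_def multi_analytic_def D_def)
  have add: "\<And>x y. x \<in> D \<Longrightarrow> y \<in> D \<Longrightarrow> \<Psi> (x + y) = \<Psi> x + \<Psi> y"
    and scale: "\<And>a x. x \<in> D \<Longrightarrow> \<Psi> (a *\<^sub>C x) = a *\<^sub>C \<Psi> x"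
    using bop by (auto simp: bounded_op_def)
  obtain C where C: "\<And>x. x \<in> D \<Longrightarrow> norm (\<Psi> x) \<le> C * norm x"
    using bop unfolding bounded_op_def by blast
  have \<Psi>_0: "\<Psi> 0 = 0" using scale[OF closed_csubspace_0[OF D], of 0] by simp
  have diff: "\<Psi> (x - y) = \<Psi> x - \<Psi> y" if "x \<in> D" "y \<in> D" for x y
    using add[OF that(1) closed_csubspace_scaleC[OF D that(2), of "-1"]] scale[OF that(2), of "-1"]
    by (simp add: scaleC_minus_one)
  define Z where "Z = {f \<in> D. \<Psi> f = 0}"
  define N where "N = {f \<in> D. \<forall>g\<in>Z. cinner f g = 0}"
  have Z: "closed_csubspace Z"
  proof -
    \<comment> \<open>\<open>\<Psi>\<close> is controlled on \<open>D\<close> alone, so closedness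
      is shown with sequences and the bound \<open>C\<close>.\<close>
    have "closed Z"
      unfolding closed_sequential_limits
    proof (intro allI impI)
      fix x l assume x: "(\<forall>m. x m \<in> Z) \<and> x \<longlonglongrightarrow> l"
      then have l: "l \<in> D"
        using D closed_sequentially[of D x l] by (auto simp: closed_csubspace_def Z_def)
      have "norm (\<Psi> l) \<le> C * norm (l - x m)" for m
        using C[OF closed_csubspace_diff[OF D l, of "x m"]] diff[OF l, of "x m"] x
        by (simp add: Z_def)
      moreover have "(\<lambda>m. C * norm (l - x m)) \<longlonglongrightarrow> C * norm (l - l)"
        using x by (intro tendsto_intros) auto
      ultimately have "norm (\<Psi> l) \<le> C * norm (l - l)"
        by (intro LIMSEQ_le_const[of "\<lambda>m. C * norm (l - x m)"]) auto
      then show "l \<in> Z" using l by (simp add: Z_def)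
    qed
    then show ?thesis
      using D by (auto simp: closed_csubspace_def Z_def add scale \<Psi>_0)
  qed
  have N: "closed_csubspace N" unfolding N_def by (rule closed_csubspace_orthogonal_in[OF D])
  have ND: "N \<subseteq> D" by (auto simp: N_def)
  have iso: "norm (\<Psi> f) = norm f" if "f \<in> N" for f
    using part that unfolding partial_isometry_on_def N_def Z_def by auto
  \<comment> \<open>Removing the kernel component leaves the image unchanged; hence
    \<open>\<Psi>\<close> already maps \<open>N\<close> onto \<open>M\<close>.\<close>
  have split: "f - orth_proj Z f \<in> N" "\<Psi> (f - orth_proj Z f) = \<Psi> f" if "f \<in> D" for f
  proof -
    have "orth_proj Z f \<in> Z" by (rule orth_proj_in[OF Z])
    then have *: "orth_proj Z f \<in> D" "\<Psi> (orth_proj Z f) = 0" by (auto simp: Z_def)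
    then show "\<Psi> (f - orth_proj Z f) = \<Psi> f" by (simp add: diff that)
    show "f - orth_proj Z f \<in> N"
      using cinner_diff_orth_proj[OF Z] closed_csubspace_diff[OF D that *(1)] by (simp add: N_def)
  qed
  have shift_D: "S i s f \<in> D" if "letter i s" "f \<in> D" for i s f
    using shift_in_l2_tensor[OF that(1) L] that(2) by (simp add: D_def)
  have coshift_N: "coshift i s f \<in> N" if ls: "letter i s" and f: "f \<in> N" for i s f
  proof -
    have "coshift i s f \<in> D" unfolding D_def
      using f ND by (intro coshift_in_l2_tensor[OF ls L]) (auto simp: D_def l2_tensor_def)
    moreover have "S i s g \<in> Z" if "g \<in> Z" for g
      using that shift_D[OF ls] by (simp add: Z_def comm[OF ls] shift_0[OF ls])
    then have "cinner (coshift i s f) g = 0" if "g \<in> Z" for g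
      using f that by (simp add: N_def flip: cinner_shift_right[OF ls])
    ultimately show ?thesis by (simp add: N_def)
  qed
  have shift_N: "S i s f \<in> N" if ls: "letter i s" and f: "f \<in> N" for i s f
  proof -
    have fD: "f \<in> D" using f ND by blast
    \<comment> \<open>The kernel component of \<open>S i s f\<close>. The remainder has the same
      image, whose norm equals that of \<open>S i s f\<close>; Pythagoras then leaves no room for
      \<open>b\<close>.\<close>
    define b where "b = orth_proj Z (S i s f)"
    have b: "b \<in> Z" unfolding b_def by (rule orth_proj_in[OF Z])
    have a: "S i s f - b \<in> N" "\<Psi> (S i s f - b) = \<Psi> (S i s f)"
      using split[OF shift_D[OF ls fD]] by (simp_all add: b_def)
    have \<Psi>f: "\<Psi> f \<in> l2_tensor W UNIV" using bop fD by (auto simp: bounded_op_def)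
    have "norm (S i s f - b) = norm (\<Psi> (S i s f))" using iso[OF a(1)] a(2) by simp
    also have "\<dots> = norm (S i s f)"
      using fD DH by (simp add: comm[OF ls fD] norm_shift[OF ls] \<Psi>f iso[OF f] subset_iff)
    finally have "(norm (S i s f - b))\<^sup>2 = (norm ((S i s f - b) + b))\<^sup>2" by simp
    also have "\<dots> = (norm (S i s f - b))\<^sup>2 + (norm b)\<^sup>2"
      using a(1) b by (intro norm_add_sq_cinner) (simp add: N_def)
    finally have "b = 0" by simp
    then show ?thesis using a(1) by simp
  qed
  have \<Psi>_cinner: "cinner (\<Psi> f) (\<Psi> g) = cinner f g" if "f \<in> N" "g \<in> N" for f g
    using that ND by (intro isometry_preserves_cinner[OF N _ _ iso]) (auto intro!: add scale)
  have MN: "\<exists>f\<in>N. x = \<Psi> f" if "x \<in> M" for x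
  proof -
    obtain f where "f \<in> D" "x = \<Psi> f" using \<open>x \<in> M\<close> M by (auto simp: D_def)
    then show ?thesis using split by metis
  qed
  show ?thesis
    unfolding wandering_invariant_def
  proof (intro ballI impI)
    fix i j t y assume i: "i \<in> {1..k}" and j: "j \<in> {1..k}" "i \<noteq> j" and t: "t \<in> {1..n j}"
      and y: "y \<in> wandering {i} M"
    have lt: "letter j t" using j t by auto
    have yM: "y \<in> M" using y wandering_subset by blast
    obtain f where f: "f \<in> N" "y = \<Psi> f" using MN[OF yM] by blast
    have "cinner (S j t y) (S i s z) = 0" if s: "s \<in> {1..n i}" and z: "z \<in> M" for s z
    proof -
      have ls: "letter i s" using i s by auto
      obtain g where g: "g \<in> N" "z = \<Psi> g" using MN[OF z] by blast
      \<comment> \<open>Testing \<open>y\<close> against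
        \<open>S i s (\<Psi> (coshift i s f))\<close> and pulling back to \<open>N\<close> shows
        that \<open>coshift i s f\<close> is orthogonal to itself.\<close>
      have c: "coshift i s f \<in> N" by (rule coshift_N[OF ls f(1)])
      then have "\<Psi> (coshift i s f) \<in> M" using ND by (auto simp: M D_def)
      then have "cinner y (S i s (\<Psi> (coshift i s f))) = 0"
        using wanderingD[OF y] s by simp
      then have "cinner f (S i s (coshift i s f)) = 0"
        using c f ND shift_N[OF ls c] by (simp add: \<Psi>_cinner subset_iff flip: comm[OF ls])
      then have f0: "coshift i s f = 0" by (simp add: cinner_shift_right[OF ls])
      have "cinner (S j t y) (S i s z) = cinner (S j t f) (S i s g)"
        using f g ND shift_N[OF ls g(1)] shift_N[OF lt f(1)]
        by (simp add: \<Psi>_cinner subset_iff flip: comm[OF ls] comm[OF lt])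
      also have "\<dots> = 0"
        by (simp add: cinner_shift_right[OF ls] coshift_shift[OF ls lt j(2)] f0 shift_0[OF lt])
      finally show ?thesis .
    qed
    then show "S j t y \<in> wandering {i} M"
      using shift_in[OF lt yM] by (simp add: wandering_def)
  qed
qed

section \<open>The Wold decomposition\<close>

context shift_model
begin

text \<open>The product of the shifts along the words of components 1 to k, in this order, so that
  the scalar in \<open>shift_word_shift\<close> is exactly \<open>phase\<close>.\<close>

definition word_shift :: "words \<Rightarrow> (words, 'a::complex_inner) l2 \<Rightarrow> (words, 'a) l2" where
  "word_shift \<alpha> x = foldr (\<lambda>i. foldr (S i) (\<alpha> i)) [1..<Suc k] x"

definition word_length :: "words \<Rightarrow> nat" where
  "word_length \<alpha> = (\<Sum>i = 1..k. length (\<alpha> i))"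

definition empty_word :: words where
  "empty_word = (\<lambda>i\<in>{1..k}. [])"

lemma empty_word_in: "empty_word \<in> W"
  by (simp add: empty_word_def Words_def)

lemma word_length_Cons:
  "i \<in> {1..k} \<Longrightarrow> word_length (\<alpha>(i := s # \<alpha> i)) = Suc (word_length \<alpha>)"
  unfolding word_length_def by (simp add: sum.remove[of _ i])

lemma Words_cases:
  assumes "\<beta> \<in> W" "i \<in> {1..k}"
  obtains "\<beta> i = []" | \<alpha> s where "\<alpha> \<in> W" "letter i s" "\<beta> = \<alpha>(i := s # \<alpha> i)"
proof (cases "\<beta> i")
  case (Cons s w)
  have "\<beta> = (\<beta>(i := w))(i := s # (\<beta>(i := w)) i)" using Cons by (simp add: fun_upd_idem)
  then show ?thesis using that(2)[of "\<beta>(i := w)" s] Words_tl[OF assms Cons] assms(2) by blast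
qed (use that in blast)

lemma Words_neq_empty:
  assumes "\<beta> \<in> W" "\<beta> \<noteq> empty_word"
  obtains i \<alpha> s where "\<alpha> \<in> W" "letter i s" "\<beta> = \<alpha>(i := s # \<alpha> i)"
proof -
  have "\<exists>i\<in>{1..k}. \<beta> i \<noteq> []"
  proof (rule ccontr)
    assume "\<not> (\<exists>i\<in>{1..k}. \<beta> i \<noteq> [])"
    then have "\<beta> = empty_word"
      using assms(1) by (auto simp: empty_word_def Words_def PiE_iff extensional_def fun_eq_iff)
    then show False using assms(2) by simp
  qed
  then show ?thesis using that Words_cases[OF assms(1)] by metis
qed

lemma Words_induct [consumes 1, case_names empty Cons]:
  assumes "\<alpha> \<in> W" and "P empty_word"
    and step: "\<And>\<alpha> i s. \<alpha> \<in> W \<Longrightarrow> letter i s \<Longrightarrow> P \<alpha> \<Longrightarrow> P (\<alpha>(i := s # \<alpha> i))"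
  shows "P \<alpha>"
  using assms(1)
proof (induction "word_length \<alpha>" arbitrary: \<alpha> rule: less_induct)
  case less
  show ?case
  proof (cases "\<alpha> = empty_word")
    case False
    then obtain i \<beta> s where "\<beta> \<in> W" "letter i s" "\<alpha> = \<beta>(i := s # \<beta> i)"
      using Words_neq_empty[OF less.prems] by metis
    then show ?thesis using step less.hyps[of \<beta>] word_length_Cons[of i \<beta> s] by auto
  qed (use assms(2) in simp)
qed

lemma foldr_shift_scaleC:
  assumes "i \<in> {1..k}" "set w \<subseteq> {1..n i}"
  shows "foldr (S i) w (a *\<^sub>C x) = a *\<^sub>C foldr (S i) w x"
  using assms(2)
proof (induction w)
  case (Cons s w)
  then have ls: "letter i s" using assms(1) by auto
  show ?case using Cons by (simp add: shift_scaleC[OF ls])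
qed simp

lemma shift_foldr_shift:
  assumes ls: "letter i s" and j: "j \<in> {1..k}" "i \<noteq> j" and "set w \<subseteq> {1..n j}"
  shows "S i s (foldr (S j) w x) = (\<Prod>t\<leftarrow>w. lam i j s t) *\<^sub>C foldr (S j) w (S i s x)"
  using assms(4)
proof (induction w)
  case (Cons t w)
  then have lt: "letter j t" using j by auto
  show ?case using Cons
    by (simp add: shift_shift[OF ls lt j(2)] shift_scaleC[OF lt] scaleC_scaleC)
qed simp

lemma shift_foldr_foldr_shift:
  assumes ls: "letter i s" and "set js \<subseteq> {1..k} - {i}" and \<alpha>: "\<And>j. j \<in> {1..k} \<Longrightarrow> set (\<alpha> j) \<subseteq> {1..n j}"
  shows "S i s (foldr (\<lambda>j. foldr (S j) (\<alpha> j)) js x) =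
    (\<Prod>j\<leftarrow>js. \<Prod>t\<leftarrow>\<alpha> j. lam i j s t) *\<^sub>C foldr (\<lambda>j. foldr (S j) (\<alpha> j)) js (S i s x)"
  using assms(2)
proof (induction js)
  case (Cons j js)
  then have j: "j \<in> {1..k}" "i \<noteq> j" by auto
  show ?case using Cons
    by (simp add: shift_foldr_shift[OF ls j \<alpha>[OF j(1)]] foldr_shift_scaleC[OF j(1) \<alpha>[OF j(1)]] scaleC_scaleC)
qed simp

text \<open>To reach component \<open>i\<close>, the shift \<open>S i s\<close> has to pass the
  components of smaller index, collecting one factor \<open>lam i j s t\<close> per letter.\<close>

lemma shift_word_shift:
  assumes ls: "letter i s" and \<alpha>: "\<alpha> \<in> W"
  shows "S i s (word_shift \<alpha> x) = phase lam i s \<alpha> *\<^sub>C word_shift (\<alpha>(i := s # \<alpha> i)) x"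
proof -
  let ?F = "\<lambda>\<alpha>. foldr (\<lambda>j. foldr (S j) (\<alpha> j))"
  have set\<alpha>: "set (\<alpha> j) \<subseteq> {1..n j}" if "j \<in> {1..k}" for j
    using \<alpha> that by (auto simp: Words_def PiE_iff)
  have split: "[1..<Suc k] = [1..<i] @ i # [Suc i..<Suc k]"
    using ls upt_add_eq_append[of 1 i "Suc k - i"] upt_conv_Cons[of i "Suc k"] by auto
  have same: "?F (\<alpha>(i := s # \<alpha> i)) js y = ?F \<alpha> js y" if "i \<notin> set js" for js and y :: "(words, 'a) l2"
    using that by (induction js) auto
  have "S i s (?F \<alpha> [1..<i] y) = phase lam i s \<alpha> *\<^sub>C ?F \<alpha> [1..<i] (S i s y)" for y :: "(words, 'a) l2"
    unfolding phase_def using ls set\<alpha>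
    by (subst shift_foldr_foldr_shift[OF ls]) (auto simp flip: prod.distinct_set_conv_list)
  moreover have "?F (\<alpha>(i := s # \<alpha> i)) [1..<i] y = ?F \<alpha> [1..<i] y"
    "?F (\<alpha>(i := s # \<alpha> i)) [Suc i..<Suc k] y = ?F \<alpha> [Suc i..<Suc k] y" for y :: "(words, 'a) l2"
    by (rule same, simp)+
  ultimately show ?thesis
    unfolding word_shift_def split by (simp only: foldr_append foldr_Cons comp_apply fun_upd_same)
qed

lemma word_shift_Cons:
  assumes ls: "letter i s" and \<alpha>: "\<alpha> \<in> W"
  shows "word_shift (\<alpha>(i := s # \<alpha> i)) x = cnj (phase lam i s \<alpha>) *\<^sub>C S i s (word_shift \<alpha> x)"
  using phase_mult_cnj[OF assms]
  by (simp add: shift_word_shift[OF assms] scaleC_scaleC mult.commute)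

lemma word_shift_empty: "word_shift empty_word x = x"
proof -
  have *: "foldr (\<lambda>i. foldr (S i) (empty_word i)) is x = x" if "set is \<subseteq> {1..k}" for "is"
    using that by (induction "is") (auto simp: empty_word_def)
  show ?thesis unfolding word_shift_def by (rule *) auto
qed

lemma word_shift_add: "\<alpha> \<in> W \<Longrightarrow> word_shift \<alpha> (x + y) = word_shift \<alpha> x + word_shift \<alpha> y"
proof (induction rule: Words_induct)
  case (Cons \<alpha> i s)
  then show ?case
    unfolding word_shift_Cons[OF Cons(2,1)] by (simp add: shift_add scaleC_add_right)
qed (simp add: word_shift_empty)

lemma word_shift_scaleC: "\<alpha> \<in> W \<Longrightarrow> word_shift \<alpha> (a *\<^sub>C x) = a *\<^sub>C word_shift \<alpha> x"
proof (induction rule: Words_induct)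
  case (Cons \<alpha> i s)
  then show ?case
    unfolding word_shift_Cons[OF Cons(2,1)] by (simp add: shift_scaleC scaleC_scaleC mult.commute)
qed (simp add: word_shift_empty)

lemma word_shift_0: "\<alpha> \<in> W \<Longrightarrow> word_shift \<alpha> 0 = 0"
  using word_shift_scaleC[of \<alpha> 0 0] by simp

end

section \<open>Orthogonality and totality of the shifted copies of the generating subspace\<close>

context invariant_subspace
begin

abbreviation "generating \<equiv> wandering {1..k} M"

lemma word_shift_in: "\<alpha> \<in> W \<Longrightarrow> x \<in> M \<Longrightarrow> word_shift \<alpha> x \<in> M"
proof (induction rule: Words_induct)
  case (Cons \<alpha> i s)
  then show ?case
    unfolding word_shift_Cons[OF Cons(2,1)] by (simp add: shift_in closed_csubspace_scaleC[OF closed])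
qed (simp add: word_shift_empty)

lemma norm_word_shift: "\<alpha> \<in> W \<Longrightarrow> x \<in> M \<Longrightarrow> norm (word_shift \<alpha> x) = norm x"
proof (induction rule: Words_induct)
  case (Cons \<alpha> i s)
  then have "word_shift \<alpha> x \<in> l2_tensor W UNIV" using word_shift_in subset by blast
  then show ?case
    using Cons unfolding word_shift_Cons[OF Cons(2,1)] by (simp add: norm_scaleC cmod_phase[OF Lambda] norm_shift)
qed (simp add: word_shift_empty)

text \<open>All letters of the word have index different from \<open>i\<close>, and the shifts by
  such letters preserve \<open>wandering {i} M\<close>.\<close>

lemma word_shift_in_wandering:
  assumes inv: "wandering_invariant M" and l: "l \<in> generating" and i: "i \<in> {1..k}"
  shows "\<alpha> \<in> W \<Longrightarrow> \<alpha> i = [] \<Longrightarrow> word_shift \<alpha> l \<in> wandering {i} M"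
proof (induction rule: Words_induct)
  case empty
  show ?case using l i by (simp add: word_shift_empty wandering_def)
next
  case (Cons \<alpha> j t)
  then have "i \<noteq> j" "word_shift \<alpha> l \<in> wandering {i} M" by (auto split: if_splits)
  then show ?case
    using shift_in_wandering[OF inv _ Cons(2), of "{i}"] i Cons(1,2)
    unfolding word_shift_Cons[OF Cons(2,1)]
    by (simp add: closed_csubspace_scaleC closed_csubspace_wandering closed)
qed

text \<open>Induction on the first word. If component \<open>i\<close> of the second is empty, its
  vector is wandering for \<open>i\<close>; if it begins with the same letter, that letter cancels;
  different letters give orthogonal ranges.\<close>

lemma word_shift_orthogonal:
  assumes inv: "wandering_invariant M" and l: "l \<in> generating" "l' \<in> generating"
  shows "\<alpha> \<in> W \<Longrightarrow> \<beta> \<in> W \<Longrightarrow> \<alpha> \<noteq> \<beta> \<Longrightarrow> cinner (word_shift \<alpha> l) (word_shift \<beta> l') = 0"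
proof (induction arbitrary: \<beta> rule: Words_induct)
  have lM: "l \<in> M" "l' \<in> M" using l wandering_subset by blast+
  {
    case empty
    then obtain i \<alpha> s where \<beta>: "\<alpha> \<in> W" "letter i s" "\<beta> = \<alpha>(i := s # \<alpha> i)"
      using Words_neq_empty[OF empty(1)] by metis
    then show ?case
      using wanderingD[OF l(1), of i s "word_shift \<alpha> l'"] word_shift_in[OF _ lM(2)]
      unfolding \<beta>(3) word_shift_Cons[OF \<beta>(2,1)]
      by (simp add: \<beta> word_shift_empty cinner_scaleC_right)
  next
    case (Cons \<alpha> i s)
    then have ls: "letter i s" by blast
    show ?case
    proof (cases rule: Words_cases[OF \<open>\<beta> \<in> W\<close>, of i])
      case 1
      show ?case using Cons by blast
    next
      case 2
      have "cinner (word_shift \<beta> l') (S i s (word_shift \<alpha> l)) = 0"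
        using wanderingD[OF word_shift_in_wandering[OF inv l(2) _ \<open>\<beta> \<in> W\<close> 2]] Cons word_shift_in[OF _ lM(1)]
        by simp
      then show ?thesis
        using Cons unfolding word_shift_Cons[OF Cons(2,1)]
        by (simp add: cinner_scaleC_left cinner_eq_0_commute[of "S i s _"])
    next
      case (3 \<gamma> t)
      have "word_shift \<alpha> l \<in> l2_tensor W UNIV" using word_shift_in[OF _ lM(1)] Cons subset by blast
      moreover have "s = t \<Longrightarrow> cinner (word_shift \<alpha> l) (word_shift \<gamma> l') = 0"
        using 3(3) Cons.prems by (intro Cons.IH[OF 3(1)]) blast
      ultimately show ?thesis
        unfolding 3(3) word_shift_Cons[OF Cons(2,1)] word_shift_Cons[OF 3(2,1)]
        by (simp add: cinner_scaleC_left cinner_scaleC_right cinner_shift_shift[OF ls 3(2)])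
    qed
  }
qed

text \<open>The subtracted terms stay in \<open>wandering A M\<close>, since shifts and compressed
  adjoints of index outside \<open>A\<close> preserve it.\<close>

lemma residual_in_wandering_insert:
  assumes inv: "wandering_invariant M" and A: "A \<subseteq> {1..k}" and i: "i \<in> {1..k}" "i \<notin> A"
    and y: "y \<in> wandering A M"
  shows "residual M i y \<in> wandering (insert i A) M"
proof -
  have yM: "y \<in> M" using y wandering_subset by blast
  have "residual M i y \<in> wandering {i} M"
    using i by (intro residual_in_wandering closed subset shift_in yM) auto
  moreover have "residual M i y \<in> wandering A M"
    unfolding residual_def using i
    by (intro closed_csubspace_diff closed_csubspace_sum closed_csubspace_wandering closed y
        shift_in_wandering[OF inv A] orth_proj_coshift_in_wandering[OF A]) auto
  ultimately show ?thesis by (simp add: wandering_def)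
qed

text \<open>The vectors of \<open>M\<close> orthogonal to all \<open>word_shift \<alpha> l\<close> form a reducing subspace \<open>R\<close>. Removing the
  components in the ranges of the shifts from \<open>x \<in> R\<close> leaves an element of \<open>R \<inter> generating = {0}\<close>, and
  does not change the coefficient of \<open>x\<close> at a word of minimal length.\<close>

lemma generating_total:
  assumes inv: "wandering_invariant M" and x: "x \<in> M"
    and orth: "\<And>\<alpha> l. \<alpha> \<in> W \<Longrightarrow> l \<in> generating \<Longrightarrow> cinner x (word_shift \<alpha> l) = 0"
  shows "x = 0"
proof -
  define V where "V = {word_shift \<alpha> l | \<alpha> l. \<alpha> \<in> W \<and> l \<in> generating}"
  define R where "R = {x \<in> M. \<forall>v\<in>V. cinner x v = 0}"
  have R: "closed_csubspace R" unfolding R_def by (rule closed_csubspace_orthogonal_in[OF closed])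
  have RM: "R \<subseteq> M" by (auto simp: R_def)
  have RD: "cinner r (word_shift \<alpha> l) = 0" if "r \<in> R" "\<alpha> \<in> W" "l \<in> generating" for r \<alpha> l
    using that by (auto simp: R_def V_def)
  have RI: "r \<in> R" if "r \<in> M" "\<And>\<alpha> l. \<alpha> \<in> W \<Longrightarrow> l \<in> generating \<Longrightarrow> cinner r (word_shift \<alpha> l) = 0" for r
    using that by (auto simp: R_def V_def)
  have shift_R: "S i s r \<in> R" if ls: "letter i s" and r: "r \<in> R" for i s r
  proof (rule RI)
    show "S i s r \<in> M" using shift_in[OF ls] RM r by blast
    fix \<alpha> l assume \<alpha>: "\<alpha> \<in> W" and l: "l \<in> generating"
    have i: "i \<in> {1..k}" using ls by blast
    show "cinner (S i s r) (word_shift \<alpha> l) = 0"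
    proof (cases rule: Words_cases[OF \<alpha> i])
      case 1
      have "cinner (word_shift \<alpha> l) (S i s r) = 0"
        using wanderingD[OF word_shift_in_wandering[OF inv l i \<alpha> 1]] ls r RM by auto
      then show ?thesis by (simp add: cinner_eq_0_commute)
    next
      case (2 \<beta> t)
      have "r \<in> l2_tensor W UNIV" using r RM subset by blast
      then show ?thesis
        using 2 ls RD[OF r 2(1) l]
        by (simp add: word_shift_Cons[OF 2(2,1)] cinner_scaleC_right cinner_shift_shift)
    qed
  qed
  have coshift_R: "orth_proj M (coshift i s r) \<in> R" if ls: "letter i s" and r: "r \<in> R" for i s r
  proof (rule RI)
    show "orth_proj M (coshift i s r) \<in> M" by (rule orth_proj_in[OF closed])
    fix \<alpha> l assume \<alpha>: "\<alpha> \<in> W" and l: "l \<in> generating"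
    have "word_shift \<alpha> l \<in> M" using word_shift_in[OF \<alpha>] l wandering_subset by blast
    then show "cinner (orth_proj M (coshift i s r)) (word_shift \<alpha> l) = 0"
      using RD[OF r Words_Cons[OF ls \<alpha>] l]
      by (simp add: cinner_orth_proj_left[OF closed] cinner_scaleC_right
          shift_word_shift[OF ls \<alpha>] flip: cinner_shift_right[OF ls])
  qed
  have residual_R: "residual M i r \<in> R" if "i \<in> {1..k}" "r \<in> R" for i r
    unfolding residual_def using that
    by (intro closed_csubspace_diff closed_csubspace_sum R shift_R coshift_R) auto
  have "l2_apply r \<alpha> = 0" if "\<alpha> \<in> W" "r \<in> R" for \<alpha> r
    using that
  proof (induction "word_length \<alpha>" arbitrary: \<alpha> r rule: less_induct)
    case less
    \<comment> \<open>Minimal length is expressed by strong induction: the coefficient of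
      \<open>S i s q\<close> at \<open>\<alpha>\<close> is zero or a multiple of a coefficient of
      \<open>q\<close> at a shorter word, which vanishes by hypothesis.\<close>
    have shift_0: "l2_apply (S i s q) \<alpha> = 0" if ls: "letter i s" and q: "q \<in> R" for i s q
    proof (cases "\<alpha> i")
      case (Cons t w)
      have i: "i \<in> {1..k}" using ls by blast
      have "word_length (\<alpha>(i := w)) < word_length \<alpha>"
        using word_length_Cons[OF i, of "\<alpha>(i := w)" t] Cons by (simp add: fun_upd_idem)
      then show ?thesis
        using less.hyps[OF _ Words_tl(1)[OF less.prems(1) i Cons] q] Cons
        by (simp add: l2_apply_shift_eq[OF ls])
    qed (simp add: l2_apply_shift_eq[OF ls])
    have residual: "l2_apply (residual M i q) \<alpha> = l2_apply q \<alpha>" if "i \<in> {1..k}" "q \<in> R" for i q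
    proof -
      have "l2_apply (\<Sum>s = 1..n i. S i s (orth_proj M (coshift i s q))) \<alpha> =
          (\<Sum>s = 1..n i. l2_apply (S i s (orth_proj M (coshift i s q))) \<alpha>)"
        by (rule linear_sum[OF bounded_linear.linear[OF bounded_linear_l2_apply]])
      also have "\<dots> = 0" using that by (intro sum.neutral ballI shift_0 coshift_R) auto
      finally show ?thesis by (simp add: residual_def)
    qed
    \<comment> \<open>Residuals are taken for one index after another; each keeps the coefficient at
      \<open>\<alpha>\<close>, and after \<open>k\<close> steps the vector is generating.\<close>
    have "\<exists>q\<in>R \<inter> wandering {1..m} M. l2_apply q \<alpha> = l2_apply r \<alpha>" if "m \<le> k" for m
      using that
    proof (induction m)
      case 0
      then show ?case using less.prems RM by (auto simp: wandering_empty)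
    next
      case (Suc m)
      then obtain q where q: "q \<in> R" "q \<in> wandering {1..m} M" "l2_apply q \<alpha> = l2_apply r \<alpha>"
        by auto
      have "residual M (Suc m) q \<in> wandering (insert (Suc m) {1..m}) M"
        using Suc.prems by (intro residual_in_wandering_insert[OF inv _ _ _ q(2)]) auto
      moreover have "insert (Suc m) {1..m} = {1..Suc m}" by auto
      ultimately show ?case
        using Suc.prems residual_R[of "Suc m" q] residual[of "Suc m" q] q by auto
    qed
    from this[of k] obtain q where q: "q \<in> R" "q \<in> generating" "l2_apply q \<alpha> = l2_apply r \<alpha>"
      by auto
    \<comment> \<open>The empty word makes \<open>q\<close> orthogonal to \<open>q\<close>
      itself.\<close>
    have "cinner q q = 0" using RD[OF q(1) empty_word_in q(2)] by (simp add: word_shift_empty)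
    then show ?case using q(3) by simp
  qed
  moreover have "x \<in> R" using x orth by (rule RI)
  ultimately show ?thesis
    using x subset by (intro l2_eqI) (auto simp: l2_tensor_def)
qed

section \<open>The Wold map and its range\<close>

definition wold :: "(words, (words, 'a) l2) l2 \<Rightarrow> (words, 'a) l2" where
  "wold f = (\<Sum>\<^sub>\<infinity>\<alpha>\<in>W. word_shift \<alpha> (l2_apply f \<alpha>))"

text \<open>The summands are pairwise orthogonal with the norms of the coefficients of
  \<open>f\<close>, so \<open>orthogonal_summable_on\<close> gives both convergence and the
  norm.\<close>

lemma
  assumes inv: "wandering_invariant M" and f: "f \<in> l2_tensor W generating"
  shows wold_summable: "(\<lambda>\<alpha>. word_shift \<alpha> (l2_apply f \<alpha>)) summable_on W"
    and norm_wold: "norm (wold f) = norm f"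
    and wold_in: "wold f \<in> M"
proof -
  have fg: "l2_apply f \<alpha> \<in> generating" for \<alpha> using f by (simp add: l2_tensor_def)
  then have fM: "l2_apply f \<alpha> \<in> M" for \<alpha> using wandering_subset by blast
  have nrm: "(norm (word_shift \<alpha> (l2_apply f \<alpha>)))\<^sup>2 = (norm (l2_apply f \<alpha>))\<^sup>2" if "\<alpha> \<in> W" for \<alpha>
    by (simp add: norm_word_shift[OF that fM])
  have "(\<lambda>\<alpha>. (norm (word_shift \<alpha> (l2_apply f \<alpha>)))\<^sup>2) summable_on W"
    using l2_summable[of f W] by (subst summable_on_cong[OF nrm])
  note orth = orthogonal_summable_on[OF _ this, simplified, OF word_shift_orthogonal[OF inv fg fg]]
  show s: "(\<lambda>\<alpha>. word_shift \<alpha> (l2_apply f \<alpha>)) summable_on W" by (rule orth(1))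
  show "wold f \<in> M" unfolding wold_def
    by (rule infsum_in_closed_csubspace[OF closed word_shift_in[OF _ fM] s])
  have "(norm (wold f))\<^sup>2 = (\<Sum>\<^sub>\<infinity>\<alpha>\<in>W. (norm (word_shift \<alpha> (l2_apply f \<alpha>)))\<^sup>2)"
    unfolding wold_def by (rule orth(2))
  also have "\<dots> = (norm f)\<^sup>2"
    unfolding norm_l2_sq[of f] using f nrm by (intro infsum_cong_neutral) (auto simp: l2_tensor_def)
  finally show "norm (wold f) = norm f" by (simp add: power2_eq_iff_nonneg)
qed

lemma wold_add:
  assumes inv: "wandering_invariant M"
    and f: "f \<in> l2_tensor W generating" and g: "g \<in> l2_tensor W generating"
  shows "wold (f + g) = wold f + wold g"
  unfolding wold_def infsum_add[OF wold_summable[OF inv f] wold_summable[OF inv g], symmetric]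
  by (intro infsum_cong) (simp add: word_shift_add)

lemma wold_scaleC:
  assumes inv: "wandering_invariant M" and f: "f \<in> l2_tensor W generating"
  shows "wold (a *\<^sub>C f) = a *\<^sub>C wold f"
proof -
  have "wold (a *\<^sub>C f) = (\<Sum>\<^sub>\<infinity>\<alpha>\<in>W. a *\<^sub>C word_shift \<alpha> (l2_apply f \<alpha>))"
    unfolding wold_def by (intro infsum_cong) (simp add: word_shift_scaleC)
  also have "\<dots> = a *\<^sub>C wold f"
    unfolding wold_def
    by (rule infsumI[OF has_sum_bounded_linear[OF bounded_linear_scaleC
            has_sum_infsum[OF wold_summable[OF inv f]]]])
  finally show ?thesis .
qed

text \<open>The coefficient of \<open>S i s f\<close> at a word with new letter \<open>s\<close>
  carries the factor \<open>phase\<close>, the same factor with which \<open>S i s\<close> lengthens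
  \<open>word_shift\<close>.\<close>

lemma wold_shift:
  assumes inv: "wandering_invariant M" and f: "f \<in> l2_tensor W generating" and ls: "letter i s"
  shows "wold (S i s f) = S i s (wold f)"
proof -
  let ?h = "\<lambda>\<alpha> :: words. \<alpha>(i := s # \<alpha> i)"
  have "wold (S i s f) = (\<Sum>\<^sub>\<infinity>\<beta>\<in>?h ` W. word_shift \<beta> (l2_apply (S i s f) \<beta>))"
    unfolding wold_def
  proof (rule infsum_cong_neutral)
    fix \<beta> assume \<beta>: "\<beta> \<in> W - ?h ` W"
    have "l2_apply (S i s f) \<beta> = 0"
    proof (rule ccontr)
      assume "l2_apply (S i s f) \<beta> \<noteq> 0"
      then obtain w where w: "\<beta> i = s # w" by (auto simp: l2_apply_shift_eq[OF ls] split: if_splits)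
      then have "\<beta> = ?h (\<beta>(i := w))" by (simp add: fun_upd_idem)
      moreover have "\<beta>(i := w) \<in> W" using Words_tl(1)[of \<beta> i s w] w \<beta> ls by blast
      ultimately show False using \<beta> by blast
    qed
    then show "word_shift \<beta> (l2_apply (S i s f) \<beta>) = 0" using \<beta> by (simp add: word_shift_0)
  qed (use Words_Cons[OF ls] in auto)
  also have "\<dots> = (\<Sum>\<^sub>\<infinity>\<alpha>\<in>W. word_shift (?h \<alpha>) (l2_apply (S i s f) (?h \<alpha>)))"
    by (subst infsum_reindex[OF inj_Cons_upd]) (simp add: o_def)
  also have "\<dots> = (\<Sum>\<^sub>\<infinity>\<alpha>\<in>W. S i s (word_shift \<alpha> (l2_apply f \<alpha>)))"
    by (intro infsum_cong)
      (simp add: l2_apply_shift_Cons[OF ls] word_shift_scaleC[OF Words_Cons[OF ls]] shift_word_shift[OF ls])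
  also have "\<dots> = S i s (wold f)"
    unfolding wold_def
    by (rule infsumI[OF has_sum_bounded_linear[OF bounded_linear_shift[OF ls]
            has_sum_infsum[OF wold_summable[OF inv f]]]])
  finally show ?thesis .
qed

lemma wold_tensor_chi:
  assumes "\<alpha> \<in> W"
  shows "wold (tensor (chi \<alpha>) l) = word_shift \<alpha> l"
proof -
  have "wold (tensor (chi \<alpha>) l) = (\<Sum>\<^sub>\<infinity>\<beta>\<in>{\<alpha>}. word_shift \<beta> l)"
    unfolding wold_def using assms by (intro infsum_cong_neutral) (auto simp: word_shift_0)
  then show ?thesis by simp
qed

text \<open>An isometry has closed range. A vector of \<open>M\<close> minus its projection onto the
  range is orthogonal to every \<open>word_shift \<alpha> l\<close>, as these lie in the range, and
  so is zero by \<open>generating_total\<close>.\<close>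

lemma wold_image:
  assumes inv: "wandering_invariant M"
  shows "wold ` l2_tensor W generating = M"
proof
  define D where "D = l2_tensor W generating"
  have D: "closed_csubspace D"
    unfolding D_def by (intro closed_csubspace_l2_tensor closed_csubspace_wandering closed)
  note add = wold_add[OF inv, folded D_def] and scale = wold_scaleC[OF inv, folded D_def]
    and nrm = norm_wold[OF inv, folded D_def]
  have diff: "wold (f - g) = wold f - wold g" if "f \<in> D" "g \<in> D" for f g
    using add[OF that(1) closed_csubspace_scaleC[OF D that(2), of "-1"]] scale[OF that(2), of "-1"]
    by (simp add: scaleC_minus_one)
  have "closed (wold ` D)"
    unfolding closed_sequential_limits
  proof (intro allI impI)
    fix y l assume y: "(\<forall>m. y m \<in> wold ` D) \<and> y \<longlonglongrightarrow> l"
    then have "\<forall>m. \<exists>f\<in>D. y m = wold f" by blast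
    then obtain f where f: "\<And>m. f m \<in> D" "\<And>m. y m = wold (f m)" by metis
    have dist: "dist (wold f) (wold g) = dist f g" if "f \<in> D" "g \<in> D" for f g
      using diff[OF that] nrm[OF closed_csubspace_diff[OF D that]] by (simp add: dist_norm)
    have "Cauchy y" using y by (blast intro: LIMSEQ_imp_Cauchy)
    then have "Cauchy f" by (simp add: Cauchy_def f dist)
    then obtain g where g: "f \<longlonglongrightarrow> g" using Cauchy_convergent convergent_def by blast
    then have gD: "g \<in> D" using D f(1) closed_sequentially[of D f g] by (simp add: closed_csubspace_def)
    have "y \<longlonglongrightarrow> wold g"
      using g by (simp add: tendsto_dist_iff[of _ "wold g"] tendsto_dist_iff[of _ g] f dist gD)
    then show "l \<in> wold ` D" using y gD LIMSEQ_unique by blast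
  qed
  moreover have "0 \<in> wold ` D"
    using scale[OF closed_csubspace_0[OF D], of 0] closed_csubspace_0[OF D] by force
  ultimately have T: "closed_csubspace (wold ` D)"
    using D by (auto simp: closed_csubspace_def simp flip: add scale)
  show sub: "wold ` l2_tensor W generating \<subseteq> M" using wold_in[OF inv] by blast
  show "M \<subseteq> wold ` l2_tensor W generating"
  proof
    fix x assume x: "x \<in> M"
    define r where "r = x - orth_proj (wold ` D) x"
    have p: "orth_proj (wold ` D) x \<in> wold ` D" by (rule orth_proj_in[OF T])
    have "r = 0"
    proof (rule generating_total[OF inv])
      show "r \<in> M" unfolding r_def using x p sub by (intro closed_csubspace_diff[OF closed]) (auto simp: D_def)
      fix \<alpha> l assume \<alpha>: "\<alpha> \<in> W" and l: "l \<in> generating"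
      have "tensor (chi \<alpha>) l \<in> D"
        using \<alpha> l closed_csubspace_0[OF closed_csubspace_wandering[OF closed]]
        by (auto simp: D_def l2_tensor_def)
      then have "word_shift \<alpha> l \<in> wold ` D" using wold_tensor_chi[OF \<alpha>, of l] by (metis imageI)
      then show "cinner r (word_shift \<alpha> l) = 0" unfolding r_def by (rule cinner_diff_orth_proj[OF T])
    qed
    then show "x \<in> wold ` l2_tensor W generating" using p by (simp add: r_def D_def)
  qed
qed

text \<open>The coefficient space is the generating subspace, which lies inside \<open>M\<close>;
  this explains the ambient type \<open>(words, 'a) l2\<close>.\<close>

lemma isometric_beurling_type_if_wandering_invariant:
  assumes inv: "wandering_invariant M"
  shows "isometric_beurling_type k n lam TYPE((words, 'a) l2) M"
  unfolding isometric_beurling_type_def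
proof (intro exI conjI)
  show "closed_csubspace generating" by (rule closed_csubspace_wandering[OF closed])
  show "M = wold ` l2_tensor W generating" using wold_image[OF inv] by simp
  have "bounded_op (l2_tensor W generating) (l2_tensor W UNIV) wold"
    unfolding bounded_op_def using wold_in[OF inv] subset
    by (auto simp: wold_add[OF inv] wold_scaleC[OF inv] norm_wold[OF inv] intro!: exI[of _ 1])
  then show "isometric_multi_analytic k n lam generating wold"
    by (simp add: isometric_multi_analytic_def multi_analytic_def isometry_on_def
        wold_shift[OF inv] norm_wold[OF inv])
qed

end

section \<open>Assembling the equivalences\<close>

lemma (in invariant_subspace) wandering_invariant_if_beurling_type:
  "beurling_type k n lam TYPE('l::chilbert_space) M \<Longrightarrow> wandering_invariant M"
  using wandering_invariant_if_inner unfolding beurling_type_def by blast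

lemma beurling_type_if_isometric:
  "isometric_beurling_type k n lam TYPE('l::chilbert_space) M \<Longrightarrow> beurling_type k n lam TYPE('l) M"
  unfolding isometric_beurling_type_def beurling_type_def isometric_multi_analytic_def
    inner_multi_analytic_def isometry_on_def partial_isometry_on_def by blast

theorem theorem5p3:
  fixes k :: nat and n :: "nat \<Rightarrow> nat"
    and lam :: "nat \<Rightarrow> nat \<Rightarrow> nat \<Rightarrow> nat \<Rightarrow> complex"
    and M :: "(words, 'a::chilbert_space) l2 set"
  assumes "k \<ge> 1" and "\<forall>i\<in>{1..k}. n i \<ge> 1" and "Lambda_system k n lam"
    and "closed_csubspace M" and "M \<subseteq> l2_tensor (Words k n) (UNIV :: 'a set)"
    and "\<forall>i\<in>{1..k}. \<forall>s\<in>{1..n i}. shift k n lam i s ` M \<subseteq> M"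
  shows
    "(beurling_type k n lam TYPE((words, 'a) l2) M \<longleftrightarrow>
        positive_op (l2_tensor (Words k n) UNIV)
          (defect_map (l2_tensor (Words k n) UNIV) k n (shift k n lam) (orth_proj M))) \<and>
     (positive_op (l2_tensor (Words k n) UNIV)
          (defect_map (l2_tensor (Words k n) UNIV) k n (shift k n lam) (orth_proj M)) \<longleftrightarrow>
        doubly_Lambda_commuting k n lam M (\<lambda>i s. restrict (shift k n lam i s) M)) \<and>
     (doubly_Lambda_commuting k n lam M (\<lambda>i s. restrict (shift k n lam i s) M) \<longleftrightarrow>
        isometric_beurling_type k n lam TYPE((words, 'a) l2) M) \<and>
     (beurling_type k n lam TYPE('l::chilbert_space) M \<longrightarrow>
        beurling_type k n lam TYPE((words, 'a) l2) M) \<and>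
     (isometric_beurling_type k n lam TYPE('l) M \<longrightarrow>
        isometric_beurling_type k n lam TYPE((words, 'a) l2) M)"
proof -
  interpret invariant_subspace k n lam M
    by unfold_locales (use assms(3-6) in blast)+
  have iso: "isometric_beurling_type k n lam TYPE((words, 'a) l2) M \<longleftrightarrow> wandering_invariant M"
    using isometric_beurling_type_if_wandering_invariant wandering_invariant_if_beurling_type
      beurling_type_if_isometric by blast
  moreover have "beurling_type k n lam TYPE((words, 'a) l2) M \<longleftrightarrow> wandering_invariant M"
    using iso wandering_invariant_if_beurling_type beurling_type_if_isometric by blast
  \<comment> \<open>A representation over any type yields \<open>wandering_invariant M\<close>, from
    which the Wold map builds one over \<open>(words, 'a) l2\<close>.\<close>
  moreover have "beurling_type k n lam TYPE('l) M \<Longrightarrow> wandering_invariant M"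
    "isometric_beurling_type k n lam TYPE('l) M \<Longrightarrow> wandering_invariant M"
    using wandering_invariant_if_beurling_type beurling_type_if_isometric by blast+
  ultimately show ?thesis
    using positive_iff_wandering_invariant doubly_Lambda_commuting_iff by blast
qed

end
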